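(* Let $K \subset \mathcal{M}$ be a set that is compact in the weak-* topology and such that every $\mu \in K$ is strictly aperiodic. Then for any $\varepsilon > 0$ there exists $m \in \mathbb{N}$ such that for any sequence of measures $\mu_1, \mu_2, \ldots, \mu_m \in K$ and any starting measure $\nu \in \mathcal{M}$ the following inequality holds: $$W(\mu_m * \mu_{m-1} * \ldots * \mu_1 * \nu, h) < \varepsilon.$$
   Context: $(\mathbb{A}, 0, +)$ is a compact metrizable abelian topological group, equipped with a shift-invariant metric $d$ inducing its topology: $d(x+\alpha, y+\alpha) = d(x,y)$ for all $\alpha, x, y \in \mathbb{A}$. $\mathcal{B}$ is the Borel $\sigma$-algebra of $\mathbb{A}$, $h$ is the Haar measure (the unique shift-invariant Borel probability measure on $\mathbb{A}$), and $\mathcal{M}$ is the space of all probability measures on $(\mathbb{A}, \mathcal{B})$. For $\mu \in \mathcal{M}$, $\mathrm{supp}(\mu)$ denotes the topological support, i.e. the smallest closed subset of full measure. A measure $\mu \in \mathcal{M}$ is called strictly aperiodic if the smallest semigroup containing $\{\alpha - \beta \mid \alpha, \beta \in \mathrm{supp}(\mu)\}$ is dense in $\mathbb{A}$. Convolution of $\mu, \nu \in \mathcal{M}$: $(\mu * \nu)(B) = \int_{\mathbb{A}} \int_{\mathbb{A}} \mathbf{1}_B(\alpha + \beta) \, d\mu(\beta) \, d\nu(\alpha)$ for all $B \in \mathcal{B}$. Wasserstein distance: for $\nu_1, \nu_2 \in \mathcal{M}$, $W(\nu_1, \nu_2) = \inf_\gamma \iint_{\mathbb{A} \times \mathbb{A}}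 d(x,y) \, d\gamma(x,y)$, where the infimum is over all Borel probability measures $\gamma$ on $\mathbb{A} \times \mathbb{A}$ whose marginals (projections on the $x$ and $y$ coordinates) are $\nu_1$ and $\nu_2$ respectively. *)

theory Defs
  imports "HOL-Probability.Probability"
begin

text \<open>
  The group is a type of sort \<open>{metric_space, topological_ab_group_add}\<close>: \<open>dist\<close> is the chosen metric
  inducing the topology. Compactness of the group and shift invariance of \<open>dist\<close> are hypotheses of
  the theorem. The space of all Borel probability measures is \<open>space (prob_algebra borel)\<close>.
\<close>

definition haar_probability :: "'a::topological_ab_group_add measure \<Rightarrow> bool" where
  "haar_probability h \<longleftrightarrow>
     h \<in> space (prob_algebra borel) \<and> (\<forall>a. distr h borel (\<lambda>x. x + a) = h)"

text \<open>
  The coarsest topology on the probability measures making every \<open>\<mu> \<mapsto> \<integral>f d\<mu>\<close>, \<open>f\<close> continuous,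
  continuous. No boundedness of \<open>f\<close> is imposed because the definition is meant for compact spaces
  only. The carrier is the whole of \<open>space (prob_algebra borel)\<close> (take \<open>U = UNIV\<close>).
\<close>

definition weak_star_topology :: "'a::topological_space measure topology" where
  "weak_star_topology = topology_generated_by
     {{\<mu> \<in> space (prob_algebra borel). (\<integral>x. f x \<partial>\<mu>) \<in> U} | (f :: 'a \<Rightarrow> real) U.
        continuous_on UNIV f \<and> open U}"

text \<open>
  That this intersection itself has full measure is \<open>measure_supp\<close> below.
\<close>

definition supp :: "'a::topological_space measure \<Rightarrow> 'a set" where
  "supp \<mu> = \<Inter>{C. closed C \<and> measure \<mu> C = 1}"

definition add_closed :: "'a::plus set \<Rightarrow> bool" where
  "add_closed S \<longleftrightarrow> (\<forall>x\<in>S. \<forall>y\<in>S. x + y \<in> S)"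

definition strictly_aperiodic :: "'a::topological_ab_group_add measure \<Rightarrow> bool" where
  "strictly_aperiodic \<mu> \<longleftrightarrow>
     closure (add_closed hull {\<alpha> - \<beta> | \<alpha> \<beta>. \<alpha> \<in> supp \<mu> \<and> \<beta> \<in> supp \<mu>}) = UNIV"

text \<open>
  The library's \<open>convolution\<close> is restricted to \<open>ordered_euclidean_space\<close>. On a compact group the set
  function below is a measure, so \<open>measure_of\<close> does not degenerate (\<open>emeasure_conv\<close> below).
\<close>

definition conv :: "'a::topological_ab_group_add measure \<Rightarrow> 'a measure \<Rightarrow> 'a measure" where
  "conv \<mu> \<nu> = measure_of UNIV (sets borel)
     (\<lambda>B. \<integral>\<^sup>+\<alpha>. \<integral>\<^sup>+\<beta>. indicator B (\<alpha> + \<beta>) \<partial>\<mu> \<partial>\<nu>)"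

definition couplings :: "'a::topological_space measure \<Rightarrow> 'a measure \<Rightarrow> ('a \<times> 'a) measure set" where
  "couplings \<nu>1 \<nu>2 = {\<gamma> \<in> space (prob_algebra borel).
     distr \<gamma> borel fst = \<nu>1 \<and> distr \<gamma> borel snd = \<nu>2}"

definition wasserstein :: "'a::metric_space measure \<Rightarrow> 'a measure \<Rightarrow> ennreal" where
  "wasserstein \<nu>1 \<nu>2 = (INF \<gamma>\<in>couplings \<nu>1 \<nu>2. \<integral>\<^sup>+(x, y). ennreal (dist x y) \<partial>\<gamma>)"


subsection \<open>Basic facts\<close>

lemma topspace_weak_star [simp]:
  "topspace weak_star_topology = space (prob_algebra (borel :: 'a::topological_space measure))"
  unfolding weak_star_topology_def topology_generated_by_topspace
proof (intro equalityI subsetI)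
  fix \<mu> :: "'a measure" assume "\<mu> \<in> space (prob_algebra borel)"
  then have "\<mu> \<in> {\<mu> \<in> space (prob_algebra borel). (\<integral>x. 0 \<partial>\<mu>) \<in> (UNIV :: real set)}" by simp
  then show "\<mu> \<in> \<Union>{{\<mu> \<in> space (prob_algebra borel). (\<integral>x. f x \<partial>\<mu>) \<in> U} | (f :: 'a \<Rightarrow> real) U.
        continuous_on UNIV f \<and> open U}"
    by (rule_tac UnionI) (auto intro!: exI[of _ "\<lambda>_. 0 :: real"] exI[of _ UNIV])
qed auto

lemma compact_metric_countable_base:
  assumes "compact (UNIV :: 'a::metric_space set)"
  obtains B :: "'a::metric_space set set" where "countable B" "\<And>b. b \<in> B \<Longrightarrow> open b"
    "\<And>S x. open S \<Longrightarrow> x \<in> S \<Longrightarrow> \<exists>b\<in>B. x \<in> b \<and> b \<subseteq> S"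
proof -
  have "\<exists>k. finite k \<and> (UNIV :: 'a set) \<subseteq> (\<Union>x\<in>k. ball x (1 / real (Suc n)))" for n
    using assms[unfolded compact_eq_totally_bounded] by auto
  then obtain k :: "nat \<Rightarrow> 'a set" where k: "\<And>n. finite (k n)"
    "\<And>n. UNIV \<subseteq> (\<Union>x\<in>k n. ball x (1 / real (Suc n)))" by metis
  let ?B = "\<Union>n. (\<lambda>x. ball x (1 / real (Suc n))) ` k n"
  show thesis
  proof (rule that[of ?B])
    show "countable ?B" using k(1) by (auto intro: countable_finite)
    show "open b" if "b \<in> ?B" for b using that by auto
    fix S :: "'a set" and x assume "open S" "x \<in> S"
    then obtain e where e: "e > 0" "ball x e \<subseteq> S" by (meson open_contains_ball)
    obtain n where n: "1 / real (Suc n) < e / 2" using e(1)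
      by (metis half_gt_zero nat_approx_posE)
    obtain y where y: "y \<in> k n" "x \<in> ball y (1 / real (Suc n))" using k(2)[of n] by blast
    have "ball y (1 / real (Suc n)) \<subseteq> ball x e"
    proof
      fix z assume z: "z \<in> ball y (1 / real (Suc n))"
      have "dist x z \<le> dist y x + dist y z" by (metis dist_commute dist_triangle)
      moreover have "dist y z < e / 2" "dist y x < e / 2"
        using z y n by (metis mem_ball less_trans)+
      ultimately show "z \<in> ball x e" by simp
    qed
    with e y show "\<exists>b\<in>?B. x \<in> b \<and> b \<subseteq> S" by blast
  qed
qed

lemma closed_supp: "closed (supp \<mu>)"
  unfolding supp_def by auto

lemma measure_supp:
  fixes \<mu> :: "'a::metric_space measure"
  assumes "compact (UNIV :: 'a set)" "\<mu> \<in> space (prob_algebra borel)"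
  shows "measure \<mu> (supp \<mu>) = 1"
proof -
  have s: "sets \<mu> = sets borel" and "prob_space \<mu>"
    using assms(2) by (auto simp: space_prob_algebra)
  interpret prob_space \<mu> by fact
  have sp: "space \<mu> = UNIV" using sets_eq_imp_space_eq[OF s] by simp
  obtain B :: "'a set set" where B: "countable B" "\<And>b. b \<in> B \<Longrightarrow> open b"
    "\<And>S x. open S \<Longrightarrow> x \<in> S \<Longrightarrow> \<exists>b\<in>B. x \<in> b \<and> b \<subseteq> S"
    using compact_metric_countable_base[OF assms(1)] by blast
  let ?N = "{b\<in>B. emeasure \<mu> b = 0}"
  have eq: "- supp \<mu> = \<Union>?N"
  proof (intro equalityI subsetI)
    fix x assume "x \<in> - supp \<mu>"
    then obtain C where C: "closed C" "measure \<mu> C = 1" "x \<notin> C" by (auto simp: supp_def)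
    then obtain b where b: "b \<in> B" "x \<in> b" "b \<subseteq> - C" using B(3)[of "- C" x] by auto
    have cs: "C \<in> sets \<mu>" using C s by simp
    have "measure \<mu> (- C) = 0" using prob_compl[OF cs] C(2) sp by (simp add: Compl_eq_Diff_UNIV)
    then have "emeasure \<mu> (- C) = 0" by (simp add: emeasure_eq_measure)
    then have "emeasure \<mu> b = 0"
      using emeasure_mono[of b "- C" \<mu>] b C(1) s by auto
    with b show "x \<in> \<Union>?N" by auto
  next
    fix x assume "x \<in> \<Union>?N"
    then obtain b where b: "b \<in> B" "emeasure \<mu> b = 0" "x \<in> b" by auto
    have bs: "b \<in> sets \<mu>" using B(2)[OF b(1)] s by simp
    have "measure \<mu> (- b) = 1"
      using prob_compl[OF bs] b(2) sp by (simp add: Compl_eq_Diff_UNIV measure_def)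
    then show "x \<in> - supp \<mu>" using b B(2)[OF b(1)] by (auto simp: supp_def intro!: exI[of _ "- b"])
  qed
  have "(\<Union>b\<in>?N. b) \<in> null_sets \<mu>"
  proof (rule null_sets_UN')
    show "countable ?N" by (rule countable_subset[OF _ B(1)]) blast
    show "b \<in> null_sets \<mu>" if "b \<in> ?N" for b using that B(2) s by auto
  qed
  then have "emeasure \<mu> (\<Union>?N) = 0" by auto
  then have "measure \<mu> (- supp \<mu>) = 0" using eq by (simp add: measure_def)
  moreover have "supp \<mu> \<in> sets \<mu>" using closed_supp[of \<mu>] s by simp
  ultimately show ?thesis using prob_compl[of "supp \<mu>"] sp by (simp add: Compl_eq_Diff_UNIV)
qed

lemma measurable_add_compact:
  assumes "compact (UNIV :: 'a::{metric_space, topological_ab_group_add} set)"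
  shows "(\<lambda>(x, y). x + y :: 'a) \<in> borel \<Otimes>\<^sub>M borel \<rightarrow>\<^sub>M borel"
proof (rule borel_measurableI)
  fix S :: "'a set" assume S: "open S"
  obtain B :: "'a set set" where B: "countable B" "\<And>b. b \<in> B \<Longrightarrow> open b"
    "\<And>S x. open S \<Longrightarrow> x \<in> S \<Longrightarrow> \<exists>b\<in>B. x \<in> b \<and> b \<subseteq> S"
    using compact_metric_countable_base[OF assms] by blast
  let ?P = "(\<lambda>(x, y). x + y) -` S :: ('a \<times> 'a) set"
  let ?I = "{p \<in> B \<times> B. fst p \<times> snd p \<subseteq> ?P}"
  have "open ?P"
    by (intro open_vimage[OF S]) (auto simp: case_prod_beta intro!: continuous_intros)
  have "?P = (\<Union>p\<in>?I. fst p \<times> snd p)"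
  proof (intro equalityI subsetI)
    fix z assume "z \<in> ?P"
    then obtain U V where UV: "open U" "open V" "z \<in> U \<times> V" "U \<times> V \<subseteq> ?P"
      using open_prod_elim[OF \<open>open ?P\<close>] by metis
    then obtain b c where "b \<in> B" "fst z \<in> b" "b \<subseteq> U" "c \<in> B" "snd z \<in> c" "c \<subseteq> V"
      using B(3)[of U "fst z"] B(3)[of V "snd z"] by (auto simp: mem_Times_iff)
    then show "z \<in> (\<Union>p\<in>?I. fst p \<times> snd p)"
      using UV(4) by (intro UN_I[of "(b, c)"]) (auto simp: mem_Times_iff)
  qed blast
  also have "\<dots> \<in> sets (borel \<Otimes>\<^sub>M borel)"
    using B by (intro sets.countable_UN' countable_subset[of ?I "B \<times> B"]) auto
  finally show "(\<lambda>(x, y). x + y) -` S \<inter> space (borel \<Otimes>\<^sub>M borel) \<in> sets (borel \<Otimes>\<^sub>M (borel :: 'a measure))"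
    by (simp add: space_pair_measure)
qed

lemma emeasure_distr_add:
  fixes \<mu> \<nu> :: "'a::{metric_space, topological_ab_group_add} measure"
  assumes "compact (UNIV :: 'a set)"
    and "\<mu> \<in> space (prob_algebra borel)" "\<nu> \<in> space (prob_algebra borel)" and B: "B \<in> sets borel"
  shows "emeasure (distr (\<nu> \<Otimes>\<^sub>M \<mu>) borel (\<lambda>(x, y). x + y)) B =
    (\<integral>\<^sup>+\<alpha>. \<integral>\<^sup>+\<beta>. indicator B (\<alpha> + \<beta>) \<partial>\<mu> \<partial>\<nu>)" (is "emeasure ?D B = _")
proof -
  have s: "sets \<mu> = sets borel" "sets \<nu> = sets borel" and "prob_space \<mu>"
    using assms(2,3) by (auto simp: space_prob_algebra)
  interpret prob_space \<mu> by fact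
  have add: "(\<lambda>(x, y). x + y) \<in> \<nu> \<Otimes>\<^sub>M \<mu> \<rightarrow>\<^sub>M borel"
    using measurable_add_compact[OF assms(1)]
    by (simp add: measurable_cong_sets[OF sets_pair_measure_cong[OF s(2,1)] refl])
  have "emeasure ?D B = (\<integral>\<^sup>+z. indicator B z \<partial>?D)" using B by simp
  also have "\<dots> = (\<integral>\<^sup>+p. indicator B (case p of (x, y) \<Rightarrow> x + y) \<partial>(\<nu> \<Otimes>\<^sub>M \<mu>))"
    using B by (intro nn_integral_distr add) auto
  also have "\<dots> = (\<integral>\<^sup>+\<alpha>. \<integral>\<^sup>+\<beta>. indicator B (\<alpha> + \<beta>) \<partial>\<mu> \<partial>\<nu>)"
    using measurable_compose[OF add borel_measurable_indicator[OF B]]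
    by (subst nn_integral_fst[symmetric]) auto
  finally show ?thesis .
qed

lemma conv_eq_distr:
  fixes \<mu> \<nu> :: "'a::{metric_space, topological_ab_group_add} measure"
  assumes "compact (UNIV :: 'a set)"
    and "\<mu> \<in> space (prob_algebra borel)" "\<nu> \<in> space (prob_algebra borel)"
  shows "conv \<mu> \<nu> = distr (\<nu> \<Otimes>\<^sub>M \<mu>) borel (\<lambda>(x, y). x + y)" (is "_ = ?D")
proof -
  have "conv \<mu> \<nu> = measure_of UNIV (sets borel) (emeasure ?D)"
    unfolding conv_def using emeasure_distr_add[OF assms]
    by (intro measure_of_eq) (auto simp: sets.sigma_sets_eq[of borel, simplified])
  also have "\<dots> = ?D" using measure_of_of_measure[of ?D] by simp
  finally show ?thesis .
qed

lemma emeasure_conv: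
  fixes \<mu> \<nu> :: "'a::{metric_space, topological_ab_group_add} measure"
  assumes "compact (UNIV :: 'a set)"
    and "\<mu> \<in> space (prob_algebra borel)" "\<nu> \<in> space (prob_algebra borel)" and "B \<in> sets borel"
  shows "emeasure (conv \<mu> \<nu>) B = (\<integral>\<^sup>+\<alpha>. \<integral>\<^sup>+\<beta>. indicator B (\<alpha> + \<beta>) \<partial>\<mu> \<partial>\<nu>)"
  using conv_eq_distr[OF assms(1-3)] emeasure_distr_add[OF assms] by simp

end

theory Submission
  imports Defs
begin

text \<open>
  Integrating a continuous \<open>f\<close> against the \<open>m\<close>-fold convolution is the same as applying to \<open>f\<close> the
  averaging operators \<open>g \<mapsto> (\<lambda>x. \<integral>s. g (x + s) \<partial>\<mu> i)\<close> and integrating the outcome against \<open>\<nu>\<close>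
  (\<open>integral_fold_conv\<close>). The operators preserve the mean under \<open>h\<close>, so it suffices that for \<open>f\<close> of
  mean zero the outcome tends to zero uniformly. In the supremum norm a single operator need not
  shrink a function at all, but in \<open>L\<^sup>2(h)\<close> it does: by \<open>integral_increment\<close>, the loss of energy
  (squared norm) is half the average, over independent \<open>s, t \<sim> \<mu>\<close>, of the squared \<open>L\<^sup>2\<close> distance
  between the translates of \<open>g\<close> by \<open>s\<close> and by \<open>t\<close>. If this vanishes, then \<open>g\<close> is invariant under
  differences of support points, hence constant by strict aperiodicity.

  The point is to make the loss uniform. All functions that occur share the modulus of continuity of
  \<open>f\<close>. For functions with that modulus, the density of the semigroup and compactness of the group
  reduce all increments, up to a small error, to those between finitely many pairs of support points
  of \<open>\<mu>\<close> (\<open>increment_le_support_increments\<close>); and a large increment between two support points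
  persists on neighbourhoods of positive mass (\<open>increment_le_energy_loss\<close>). Positive mass of a ball
  is stable under weak-* perturbation of \<open>\<mu>\<close>, so compactness of \<open>K\<close> gives one constant that
  is lost by every function of mean zero whose energy is not yet small, for every \<open>\<mu> \<in> K\<close>
  (\<open>energy_loss_uniform\<close>). After boundedly many steps the energy is small, and with the modulus
  also the supremum norm (\<open>sup_le_energy\<close>).

  For the Wasserstein distance, a fine partition of unity supplies finitely many test functions;
  a measure whose integrals of these are close to those of \<open>h\<close> is coupled to \<open>h\<close> by an
  explicit density that keeps most of the mass within the pieces (\<open>wasserstein_le_partition\<close>).
\<close>

section \<open>Probability measures on compact metric spaces\<close>

abbreviation borel_probs :: "'a::topological_space measure set" where
  "borel_probs \<equiv> space (prob_algebra borel)"

lemma borel_probsD: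
  assumes "\<mu> \<in> borel_probs"
  shows "prob_space \<mu>" "sets \<mu> = sets borel" "space \<mu> = UNIV"
  using assms sets_eq_imp_space_eq[of \<mu> borel] by (auto simp: space_prob_algebra)

lemma integrable_bounded_borel:
  fixes f :: "'a::topological_space \<Rightarrow> real"
  assumes \<mu>: "\<mu> \<in> borel_probs" and "f \<in> borel_measurable borel" and "\<And>x. \<bar>f x\<bar> \<le> M"
  shows "integrable \<mu> f"
proof -
  interpret prob_space \<mu> by (rule borel_probsD(1)[OF \<mu>])
  show ?thesis
    using assms(2,3) borel_probsD(2)[OF \<mu>]
    by (intro integrable_const_bound[of _ M]) (auto cong: measurable_cong_sets)
qed

lemma continuous_bounded:
  fixes f :: "'a::topological_space \<Rightarrow> real"
  assumes "compact (UNIV :: 'a set)" "continuous_on UNIV f"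
  obtains M where "M > 0" "\<And>x. \<bar>f x\<bar> \<le> M"
proof -
  have "bounded (range f)"
    using compact_imp_bounded[OF compact_continuous_image[OF assms(2,1)]] .
  then show thesis using that by (auto simp: bounded_pos)
qed

lemma integrable_continuous:
  fixes f :: "'a::topological_space \<Rightarrow> real"
  assumes "compact (UNIV :: 'a set)" "\<mu> \<in> borel_probs" "continuous_on UNIV f"
  shows "integrable \<mu> f"
proof -
  obtain M where "\<And>x. \<bar>f x\<bar> \<le> M" using continuous_bounded[OF assms(1,3)] by blast
  then show ?thesis
    using assms(2,3) by (intro integrable_bounded_borel[of _ _ M] borel_measurable_continuous_onI)
qed

text \<open>
  A compact metric space has a countable base, so an open set of the product is a countable union of
  open rectangles. Compactness is a hypothesis here, which rules out the lemma \<open>borel_prod\<close> for the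
  class of second countable types.
\<close>

lemma sets_borel_pair_compact:
  assumes "compact (UNIV :: 'a::metric_space set)" "compact (UNIV :: 'b::metric_space set)"
  shows "sets (borel \<Otimes>\<^sub>M borel) = sets (borel :: ('a \<times> 'b) measure)"
proof
  show "sets (borel \<Otimes>\<^sub>M borel) \<subseteq> sets (borel :: ('a \<times> 'b) measure)"
  proof (rule sets_pair_in_sets)
    fix A :: "'a set" and B :: "'b set"
    assume "A \<in> sets borel" "B \<in> sets borel"
    moreover have "fst \<in> (borel :: ('a \<times> 'b) measure) \<rightarrow>\<^sub>M borel" "snd \<in> (borel :: ('a \<times> 'b) measure) \<rightarrow>\<^sub>M borel"
      by (intro borel_measurable_continuous_onI continuous_intros)+
    ultimately have "fst -` A \<inter> space (borel :: ('a \<times> 'b) measure) \<in> sets borel"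
        "snd -` B \<inter> space (borel :: ('a \<times> 'b) measure) \<in> sets borel"
      using measurable_sets by blast+
    then have "(fst -` A) \<inter> (snd -` B) \<in> sets (borel :: ('a \<times> 'b) measure)" by auto
    also have "(fst -` A) \<inter> (snd -` B) = A \<times> B" by auto
    finally show "A \<times> B \<in> sets borel" .
  qed
next
  obtain B :: "'a set set" where B: "countable B" "\<And>b. b \<in> B \<Longrightarrow> open b"
    "\<And>S x. open S \<Longrightarrow> x \<in> S \<Longrightarrow> \<exists>b\<in>B. x \<in> b \<and> b \<subseteq> S"
    using compact_metric_countable_base[OF assms(1)] by blast
  obtain C :: "'b set set" where C: "countable C" "\<And>b. b \<in> C \<Longrightarrow> open b"
    "\<And>S x. open S \<Longrightarrow> x \<in> S \<Longrightarrow> \<exists>b\<in>C. x \<in> b \<and> b \<subseteq> S"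
    using compact_metric_countable_base[OF assms(2)] by blast
  have "S \<in> sets (borel \<Otimes>\<^sub>M borel)" if "open S" for S :: "('a \<times> 'b) set"
  proof -
    let ?I = "{p \<in> B \<times> C. fst p \<times> snd p \<subseteq> S}"
    have "S = (\<Union>p\<in>?I. fst p \<times> snd p)"
    proof (intro equalityI subsetI)
      fix z assume "z \<in> S"
      then obtain U V where UV: "open U" "open V" "z \<in> U \<times> V" "U \<times> V \<subseteq> S"
        using open_prod_elim[OF \<open>open S\<close>] by metis
      then obtain b c where "b \<in> B" "fst z \<in> b" "b \<subseteq> U" "c \<in> C" "snd z \<in> c" "c \<subseteq> V"
        using B(3)[of U "fst z"] C(3)[of V "snd z"] by (auto simp: mem_Times_iff)
      then show "z \<in> (\<Union>p\<in>?I. fst p \<times> snd p)"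
        using UV(4) by (intro UN_I[of "(b, c)"]) (auto simp: mem_Times_iff)
    qed blast
    also have "\<dots> \<in> sets (borel \<Otimes>\<^sub>M borel)"
      using B C by (intro sets.countable_UN' countable_subset[of ?I "B \<times> C"]) auto
    finally show ?thesis .
  qed
  then have "sigma_sets (space ((borel :: 'a measure) \<Otimes>\<^sub>M (borel :: 'b measure))) {S. open S} \<subseteq> sets ((borel :: 'a measure) \<Otimes>\<^sub>M (borel :: 'b measure))"
    by (intro sets.sigma_sets_subset) auto
  moreover have "sets (borel :: ('a \<times> 'b) measure) = sigma_sets UNIV {S. open S}"
    by (simp add: borel_def)
  ultimately show "sets (borel :: ('a \<times> 'b) measure) \<subseteq> sets (borel \<Otimes>\<^sub>M borel)"
    by (simp add: space_pair_measure)
qed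

lemma compact_UNIV_prod:
  assumes "compact (UNIV :: 'a::topological_space set)" "compact (UNIV :: 'b::topological_space set)"
  shows "compact (UNIV :: ('a \<times> 'b) set)"
  using compact_Times[OF assms] by simp

lemma pair_measure_borel_probs:
  fixes \<mu> :: "'a::metric_space measure" and \<nu> :: "'b::metric_space measure"
  assumes "compact (UNIV :: 'a set)" "compact (UNIV :: 'b set)" "\<mu> \<in> borel_probs" "\<nu> \<in> borel_probs"
  shows "\<mu> \<Otimes>\<^sub>M \<nu> \<in> borel_probs"
proof -
  interpret M: prob_space \<mu> by (rule borel_probsD(1)) fact
  interpret N: prob_space \<nu> by (rule borel_probsD(1)) fact
  interpret pair_prob_space \<mu> \<nu> ..
  have "sets (\<mu> \<Otimes>\<^sub>M \<nu>) = sets (borel \<Otimes>\<^sub>M borel)"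
    by (intro sets_pair_measure_cong borel_probsD(2) assms)
  then show ?thesis
    using sets_borel_pair_compact[OF assms(1,2)] prob_space_axioms by (simp add: space_prob_algebra)
qed

lemma fubini_continuous:
  fixes \<mu> :: "'a::metric_space measure" and \<nu> :: "'b::metric_space measure" and F :: "'a \<times> 'b \<Rightarrow> real"
  assumes "compact (UNIV :: 'a set)" "compact (UNIV :: 'b set)" "\<mu> \<in> borel_probs" "\<nu> \<in> borel_probs"
    and "continuous_on UNIV F"
  shows "(\<integral>x. \<integral>y. F (x, y) \<partial>\<nu> \<partial>\<mu>) = (\<integral>p. F p \<partial>(\<mu> \<Otimes>\<^sub>M \<nu>))"
    and "(\<integral>y. \<integral>x. F (x, y) \<partial>\<mu> \<partial>\<nu>) = (\<integral>p. F p \<partial>(\<mu> \<Otimes>\<^sub>M \<nu>))"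
    and "integrable \<mu> (\<lambda>x. \<integral>y. F (x, y) \<partial>\<nu>)"
    and "integrable \<nu> (\<lambda>y. \<integral>x. F (x, y) \<partial>\<mu>)"
proof -
  interpret M: prob_space \<mu> by (rule borel_probsD(1)) fact
  interpret N: prob_space \<nu> by (rule borel_probsD(1)) fact
  interpret pair_prob_space \<mu> \<nu> ..
  have F: "integrable (\<mu> \<Otimes>\<^sub>M \<nu>) F"
    by (intro integrable_continuous compact_UNIV_prod pair_measure_borel_probs assms)
  then have F': "integrable (\<mu> \<Otimes>\<^sub>M \<nu>) (\<lambda>(x, y). F (x, y))" by simp
  show "(\<integral>x. \<integral>y. F (x, y) \<partial>\<nu> \<partial>\<mu>) = (\<integral>p. F p \<partial>(\<mu> \<Otimes>\<^sub>M \<nu>))" by (rule integral_fst'[OF F])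
  show "integrable \<mu> (\<lambda>x. \<integral>y. F (x, y) \<partial>\<nu>)" by (rule integrable_fst'[OF F])
  show "(\<integral>y. \<integral>x. F (x, y) \<partial>\<mu> \<partial>\<nu>) = (\<integral>p. F p \<partial>(\<mu> \<Otimes>\<^sub>M \<nu>))" using integral_snd[OF F'] by simp
  show "integrable \<nu> (\<lambda>y. \<integral>x. F (x, y) \<partial>\<mu>)" using integrable_snd[OF F'] by simp
qed

section \<open>Moduli of continuity and averages of translates\<close>

text \<open>
  The modulus is a function of the displacement in the group instead of a distance, so that averages
  of translates inherit it unchanged.
\<close>

definition has_modulus :: "('a::plus \<Rightarrow> real) \<Rightarrow> ('a \<Rightarrow> real) \<Rightarrow> bool" where
  "has_modulus w g \<longleftrightarrow> (\<forall>x s. \<bar>g (x + s) - g x\<bar> \<le> w s)"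

text \<open>
  The Markov operator on functions dual to the convolution \<open>\<nu> \<mapsto> conv \<mu> \<nu>\<close>.
\<close>

definition translation_average :: "'a::plus measure \<Rightarrow> ('a \<Rightarrow> real) \<Rightarrow> 'a \<Rightarrow> real" where
  "translation_average \<mu> g x = (\<integral>s. g (x + s) \<partial>\<mu>)"

lemma has_modulusD:
  "has_modulus w g \<Longrightarrow> \<bar>g (x + s) - g x\<bar> \<le> w s"
  by (simp add: has_modulus_def)

lemma tendsto_modulus:
  fixes w :: "'a::topological_ab_group_add \<Rightarrow> real"
  assumes "(w \<longlongrightarrow> 0) (nhds 0)"
  shows "((\<lambda>s. w (s - a)) \<longlongrightarrow> 0) (nhds a)"
proof (rule filterlim_compose[OF assms])
  have "((\<lambda>s. s - a) \<longlongrightarrow> a - a) (nhds a)" by (intro tendsto_intros filterlim_ident)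
  then show "((\<lambda>s. s - a) \<longlongrightarrow> 0) (nhds a)" by simp
qed

lemma modulus_small_ball:
  fixes w :: "'a::{metric_space, topological_ab_group_add} \<Rightarrow> real"
  assumes "(w \<longlongrightarrow> 0) (nhds 0)" "e > 0"
  obtains r where "r > 0" "\<And>s. s \<in> ball a r \<Longrightarrow> w (s - a) < e"
  using order_tendstoD(2)[OF tendsto_modulus[OF assms(1), of a] assms(2)] that
  by (auto simp: eventually_nhds_metric dist_commute)

lemma has_modulus_continuous:
  fixes g :: "'a::topological_ab_group_add \<Rightarrow> real"
  assumes "(w \<longlongrightarrow> 0) (nhds 0)" "has_modulus w g"
  shows "continuous_on UNIV g"
proof -
  have "(g \<longlongrightarrow> g a) (at a)" for a
  proof -
    have "((\<lambda>x. g x - g a) \<longlongrightarrow> 0) (at a)"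
    proof (rule Lim_null_comparison)
      show "((\<lambda>s. w (s - a)) \<longlongrightarrow> 0) (at a)"
        using tendsto_modulus[OF assms(1)] by (rule tendsto_mono[rotated]) (simp add: at_within_def)
      show "\<forall>\<^sub>F x in at a. norm (g x - g a) \<le> w (x - a)"
        using has_modulusD[OF assms(2), of a "_ - a"] by (simp add: always_eventually)
    qed
    then show ?thesis by (rule Lim_null[THEN iffD2])
  qed
  then show ?thesis by (simp add: continuous_on_def)
qed

lemma continuous_on_translate:
  fixes g :: "'a::topological_ab_group_add \<Rightarrow> real"
  assumes "continuous_on UNIV g"
  shows "continuous_on UNIV (\<lambda>x. g (x + a))" "continuous_on UNIV (\<lambda>x. g (a + x))"
  by (intro continuous_on_compose2[OF assms] continuous_intros; simp)+

context
  assumes compact: "compact (UNIV :: 'a::{metric_space, topological_ab_group_add} set)"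
begin

lemma exists_modulus:
  fixes f :: "'a \<Rightarrow> real"
  assumes f: "continuous_on UNIV f"
  obtains w where "(w \<longlongrightarrow> 0) (nhds 0)" "has_modulus w f"
proof
  define w where "w s = (SUP x. \<bar>f (x + s) - f x\<bar>)" for s
  obtain M where M: "\<And>x. \<bar>f x\<bar> \<le> M" using continuous_bounded[OF compact f] by blast
  have bdd: "bdd_above (range (\<lambda>x. \<bar>f (x + s) - f x\<bar>))" for s
  proof (rule bdd_aboveI2)
    show "\<bar>f (x + s) - f x\<bar> \<le> 2 * M" for x using M[of x] M[of "x + s"] by linarith
  qed
  show "has_modulus w f"
    unfolding has_modulus_def w_def by (auto intro!: cSUP_upper bdd)
  have nonneg: "0 \<le> w s" for s
    using has_modulusD[OF \<open>has_modulus w f\<close>, of undefined s] by linarith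
  have "uniformly_continuous_on UNIV (\<lambda>p :: 'a \<times> 'a. f (fst p + snd p))"
    by (intro compact_uniformly_continuous compact_UNIV_prod compact continuous_on_compose2[OF f])
       (auto intro!: continuous_intros)
  then have unif: "\<exists>d>0. \<forall>p p'. dist p' p < d \<longrightarrow> \<bar>f (fst p' + snd p') - f (fst p + snd p)\<bar> < e"
    if "e > 0" for e
    using that unfolding uniformly_continuous_on_def dist_real_def by auto
  show "(w \<longlongrightarrow> 0) (nhds 0)"
  proof (rule tendstoI)
    fix e :: real assume "e > 0"
    then obtain d where d: "d > 0"
      "\<And>p p'. dist p' p < d \<Longrightarrow> \<bar>f (fst p' + snd p') - f (fst p + snd p)\<bar> < e / 2"
      using unif[of "e / 2"] by auto
    have "dist (w s) 0 < e" if "dist s 0 < d" for s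
    proof -
      have "w s \<le> e / 2"
        unfolding w_def
        using d(2)[of "(_, s)" "(_, 0)"] that
        by (intro cSUP_least) (auto simp: dist_Pair_Pair less_imp_le)
      with nonneg[of s] \<open>e > 0\<close> show ?thesis by simp
    qed
    with d(1) show "\<forall>\<^sub>F s in nhds 0. dist (w s) 0 < e" by (auto simp: eventually_nhds_metric)
  qed
qed

lemma has_modulus_translation_average:
  fixes g :: "'a \<Rightarrow> real"
  assumes "\<mu> \<in> borel_probs" "has_modulus w g" "continuous_on UNIV g"
  shows "has_modulus w (translation_average \<mu> g)"
  unfolding has_modulus_def
proof (intro allI)
  fix x u
  interpret prob_space \<mu> by (rule borel_probsD(1)) fact
  have int: "integrable \<mu> (\<lambda>s. g (y + s))" for y
    by (intro integrable_continuous compact assms continuous_on_translate)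
  have b: "\<bar>g (x + u + s) - g (x + s)\<bar> \<le> w u" for s
    using has_modulusD[OF assms(2), of "x + s" u] by (simp add: ac_simps)
  have "translation_average \<mu> g (x + u) - translation_average \<mu> g x
      = (\<integral>s. g (x + u + s) - g (x + s) \<partial>\<mu>)"
    unfolding translation_average_def using int by simp
  moreover have "\<dots> \<le> w u" using b int by (intro integral_le_const) (auto simp: abs_le_iff)
  moreover have "- w u \<le> (\<integral>s. g (x + u + s) - g (x + s) \<partial>\<mu>)"
    using b int by (intro integral_ge_const AE_I2) (auto simp: abs_le_iff intro: minus_le_iff[THEN iffD1])
  ultimately show "\<bar>translation_average \<mu> g (x + u) - translation_average \<mu> g x\<bar> \<le> w u"
    by linarith
qed

lemma conv_borel_probs:
  fixes \<mu> \<nu> :: "'a measure"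
  assumes "\<mu> \<in> borel_probs" "\<nu> \<in> borel_probs"
  shows "conv \<mu> \<nu> \<in> borel_probs"
proof -
  have P: "\<nu> \<Otimes>\<^sub>M \<mu> \<in> borel_probs" by (intro pair_measure_borel_probs compact assms)
  interpret prob_space "\<nu> \<Otimes>\<^sub>M \<mu>" by (rule borel_probsD(1)[OF P])
  have "(\<lambda>(x, y). x + y) \<in> \<nu> \<Otimes>\<^sub>M \<mu> \<rightarrow>\<^sub>M borel"
    using borel_probsD(2)[OF P] sets_borel_pair_compact[OF compact compact]
      measurable_add_compact[OF compact] by (metis measurable_cong_sets)
  then show ?thesis
    unfolding conv_eq_distr[OF compact assms] by (auto simp: space_prob_algebra intro!: prob_space_distr)
qed

lemma integral_conv:
  fixes \<mu> \<nu> :: "'a measure"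
  assumes "\<mu> \<in> borel_probs" "\<nu> \<in> borel_probs" and f: "continuous_on UNIV f"
  shows "(\<integral>x. f x \<partial>conv \<mu> \<nu>) = (\<integral>x. translation_average \<mu> f x \<partial>\<nu>)"
proof -
  have P: "\<nu> \<Otimes>\<^sub>M \<mu> \<in> borel_probs" by (intro pair_measure_borel_probs compact assms)
  have "(\<lambda>(x, y). x + y) \<in> \<nu> \<Otimes>\<^sub>M \<mu> \<rightarrow>\<^sub>M borel"
    using borel_probsD(2)[OF P] sets_borel_pair_compact[OF compact compact]
      measurable_add_compact[OF compact] by (metis measurable_cong_sets)
  then have "(\<integral>x. f x \<partial>conv \<mu> \<nu>) = (\<integral>p. f (fst p + snd p) \<partial>(\<nu> \<Otimes>\<^sub>M \<mu>))"
    unfolding conv_eq_distr[OF compact assms(1,2)]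
    by (subst integral_distr) (auto intro!: borel_measurable_continuous_onI f simp: case_prod_beta)
  also have "\<dots> = (\<integral>x. \<integral>y. f (x + y) \<partial>\<mu> \<partial>\<nu>)"
    by (subst fubini_continuous(1)[symmetric, OF compact compact assms(2,1)])
       (auto intro!: continuous_on_compose2[OF f] continuous_intros)
  finally show ?thesis by (simp add: translation_average_def)
qed

text \<open>
  Testing the random walk against \<open>f\<close> amounts to averaging \<open>f\<close> over translates, the last step of
  the walk first.
\<close>

lemma integral_fold_conv:
  fixes f :: "'a \<Rightarrow> real"
  assumes "set ms \<subseteq> borel_probs" "\<nu> \<in> borel_probs"
    and w: "(w \<longlongrightarrow> 0) (nhds 0)" "has_modulus w f"
  shows "has_modulus w (foldr translation_average ms f)
    \<and> fold conv ms \<nu> \<in> borel_probs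
    \<and> (\<integral>x. f x \<partial>fold conv ms \<nu>) = (\<integral>x. foldr translation_average ms f x \<partial>\<nu>)"
  using assms(1,2)
proof (induction ms arbitrary: \<nu>)
  case Nil
  then show ?case using w by simp
next
  case (Cons \<mu> ms)
  note IH = Cons.IH[of "conv \<mu> \<nu>"]
  have c: "conv \<mu> \<nu> \<in> borel_probs" using Cons.prems by (intro conv_borel_probs) auto
  then have m: "has_modulus w (foldr translation_average ms f)" using IH Cons.prems by simp
  note cont = has_modulus_continuous[OF w(1) m]
  show ?case
    using IH c Cons.prems integral_conv[OF _ _ cont, of \<mu> \<nu>]
      has_modulus_translation_average[OF _ m cont, of \<mu>] by simp
qed

end

section \<open>The energy of a function and of its translates\<close>

definition energy :: "'a measure \<Rightarrow> ('a \<Rightarrow> real) \<Rightarrow> real" where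
  "energy h g = (\<integral>x. (g x)\<^sup>2 \<partial>h)"

text \<open>
  The squared distance in \<open>L\<^sup>2(h)\<close> between two translates of \<open>g\<close>.
\<close>

definition increment :: "'a::plus measure \<Rightarrow> ('a \<Rightarrow> real) \<Rightarrow> 'a \<Rightarrow> 'a \<Rightarrow> real" where
  "increment h g s t = (\<integral>x. (g (x + s) - g (x + t))\<^sup>2 \<partial>h)"

lemma increment_commute: "increment h g s t = increment h g t s"
  unfolding increment_def by (simp add: power2_commute)

lemma increment_nonneg: "0 \<le> increment h g s t"
  unfolding increment_def by simp

lemma energy_nonneg: "0 \<le> energy h g"
  unfolding energy_def by simp

context
  fixes h :: "'a::{metric_space, topological_ab_group_add} measure"
  assumes haar: "haar_probability h"
begin

lemma haar_borel_probs: "h \<in> borel_probs"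
  using haar by (simp add: haar_probability_def)

lemma measurable_translate: "(\<lambda>x. x + a) \<in> h \<rightarrow>\<^sub>M borel" for a :: 'a
proof -
  have "(\<lambda>x. x + a) \<in> borel \<rightarrow>\<^sub>M borel" by (intro borel_measurable_continuous_onI continuous_intros)
  then show ?thesis using borel_probsD(2)[OF haar_borel_probs] by (simp cong: measurable_cong_sets)
qed

lemma integral_haar_translate:
  fixes f :: "'a \<Rightarrow> real"
  assumes "continuous_on UNIV f"
  shows "(\<integral>x. f (x + a) \<partial>h) = (\<integral>x. f x \<partial>h)"
proof -
  have "(\<integral>x. f x \<partial>distr h borel (\<lambda>x. x + a)) = (\<integral>x. f (x + a) \<partial>h)"
    using assms by (intro integral_distr measurable_translate borel_measurable_continuous_onI)
  then show ?thesis using haar by (simp add: haar_probability_def)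
qed

context
  assumes compact: "compact (UNIV :: 'a set)"
begin

text \<open>
  Finitely many translates of \<open>U\<close> cover the group, and they all have the measure of \<open>U\<close>.
\<close>

lemma haar_open_pos:
  assumes "open U" "U \<noteq> {}"
  shows "measure h U > 0"
proof (rule ccontr)
  interpret prob_space h by (rule borel_probsD(1)[OF haar_borel_probs])
  note h = borel_probsD(2,3)[OF haar_borel_probs]
  assume "\<not> measure h U > 0"
  then have 0: "emeasure h U = 0" by (simp add: emeasure_eq_measure not_less measure_le_0_iff)
  obtain u where u: "u \<in> U" using assms(2) by blast
  define V where "V a = (\<lambda>x. x + a) -` U" for a
  have V: "open (V a)" for a
    unfolding V_def by (intro open_vimage assms continuous_intros)
  have "emeasure h (V a) = 0" for a
  proof -
    have "emeasure (distr h borel (\<lambda>x. x + a)) U = emeasure h (V a)"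
      unfolding V_def using assms(1) h by (subst emeasure_distr[OF measurable_translate]) auto
    then show ?thesis using 0 haar by (simp add: haar_probability_def)
  qed
  then have null: "V a \<in> null_sets h" for a using V h by (auto intro!: null_setsI)
  have "x \<in> V (u - x)" for x using u by (simp add: V_def)
  then have "UNIV \<subseteq> (\<Union>a\<in>UNIV. V a)" by blast
  then obtain A where A: "finite A" "UNIV \<subseteq> (\<Union>a\<in>A. V a)"
    using compactE_image[OF compact, of UNIV V] V by metis
  have "(\<Union>a\<in>A. V a) \<in> null_sets h" using A(1) null by (intro null_sets_UN' countable_finite) auto
  moreover have "(\<Union>a\<in>A. V a) = space h" using A(2) h by auto
  ultimately show False using emeasure_space_1 by auto
qed

lemma integral_haar_pos:
  fixes f :: "'a \<Rightarrow> real"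
  assumes f: "continuous_on UNIV f" "\<And>x. 0 \<le> f x" "f a > 0"
  shows "(\<integral>x. f x \<partial>h) > 0"
proof -
  interpret prob_space h by (rule borel_probsD(1)[OF haar_borel_probs])
  note h = borel_probsD(2,3)[OF haar_borel_probs]
  define U where "U = {x. f a / 2 < f x}"
  have U: "open U" unfolding U_def by (intro open_Collect_less f continuous_intros)
  moreover have "U \<noteq> {}" using f(3) by (auto simp: U_def intro!: exI[of _ a])
  ultimately have "0 < f a / 2 * measure h U"
    using haar_open_pos[of U] f(3) by (intro mult_pos_pos) auto
  also have "\<dots> = (\<integral>x. f a / 2 * indicator U x \<partial>h)" using h by simp
  also have "\<dots> \<le> (\<integral>x. f x \<partial>h)"
    using U h f(2) by (intro integral_mono integrable_continuous[OF compact haar_borel_probs f(1)] integrable_mult_right integrable_real_indicator)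
      (auto simp: U_def indicator_def emeasure_eq_measure less_imp_le)
  finally show ?thesis .
qed

lemma integral_translation_average:
  fixes g :: "'a \<Rightarrow> real"
  assumes "\<mu> \<in> borel_probs" and g: "continuous_on UNIV g"
  shows "integrable h (translation_average \<mu> g)"
    and "(\<integral>x. translation_average \<mu> g x \<partial>h) = (\<integral>x. g x \<partial>h)"
proof -
  interpret prob_space \<mu> by (rule borel_probsD(1)) fact
  have F: "continuous_on UNIV (\<lambda>p. g (fst p + snd p))"
    by (intro continuous_on_compose2[OF g]) (auto intro!: continuous_intros)
  note fub = fubini_continuous[OF compact compact haar_borel_probs assms(1) F, simplified]
  show "integrable h (translation_average \<mu> g)"
    unfolding translation_average_def by (rule fub(3))
  have "(\<integral>x. translation_average \<mu> g x \<partial>h) = (\<integral>s. \<integral>x. g (x + s) \<partial>h \<partial>\<mu>)"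
    unfolding translation_average_def fub(1,2) ..
  also have "\<dots> = (\<integral>x. g x \<partial>h)" using prob_space by (simp add: integral_haar_translate[OF g])
  finally show "(\<integral>x. translation_average \<mu> g x \<partial>h) = (\<integral>x. g x \<partial>h)" .
qed

text \<open>
  For each \<open>x\<close>, the variance of \<open>g (x + s)\<close> under \<open>s \<sim> \<mu>\<close> is half the mean of
  \<open>(g (x + s) - g (x + t))\<^sup>2\<close> over independent \<open>s, t \<sim> \<mu>\<close>; integrating over \<open>x\<close> turns the
  second moments into energies.
\<close>

lemma integral_increment:
  fixes g :: "'a \<Rightarrow> real"
  assumes \<mu>: "\<mu> \<in> borel_probs" and g: "continuous_on UNIV g"
    and Tg: "continuous_on UNIV (translation_average \<mu> g)"
  shows "integrable (\<mu> \<Otimes>\<^sub>M \<mu>) (\<lambda>p. increment h g (fst p) (snd p))"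
    and "(\<integral>p. increment h g (fst p) (snd p) \<partial>(\<mu> \<Otimes>\<^sub>M \<mu>))
      = 2 * energy h g - 2 * energy h (translation_average \<mu> g)"
proof -
  interpret prob_space \<mu> by (rule borel_probsD(1)) fact
  note prod = compact_UNIV_prod[OF compact compact] pair_measure_borel_probs[OF compact compact \<mu> \<mu>]
  let ?F = "\<lambda>q :: 'a \<times> 'a \<times> 'a. (g (fst q + fst (snd q)) - g (fst q + snd (snd q)))\<^sup>2"
  have F: "continuous_on UNIV ?F"
    by (intro continuous_intros continuous_on_compose2[OF g]; simp)
  note fub = fubini_continuous[OF compact prod(1) haar_borel_probs prod(2) F, simplified]
  show "integrable (\<mu> \<Otimes>\<^sub>M \<mu>) (\<lambda>p. increment h g (fst p) (snd p))"
    unfolding increment_def by (rule fub(4))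
  have g2: "continuous_on UNIV (\<lambda>x. (g x)\<^sup>2)" by (intro continuous_intros g)
  let ?T = "translation_average \<mu> g" and ?T2 = "translation_average \<mu> (\<lambda>x. (g x)\<^sup>2)"
  have inner: "(\<integral>p. ?F (x, p) \<partial>(\<mu> \<Otimes>\<^sub>M \<mu>)) = 2 * ?T2 x - 2 * (?T x)\<^sup>2" for x
  proof -
    have i: "integrable \<mu> (\<lambda>s. g (x + s))" "integrable \<mu> (\<lambda>s. (g (x + s))\<^sup>2)"
      by (intro integrable_continuous compact \<mu> continuous_on_translate g g2)+
    have "(\<integral>p. ?F (x, p) \<partial>(\<mu> \<Otimes>\<^sub>M \<mu>)) = (\<integral>s. \<integral>t. (g (x + s) - g (x + t))\<^sup>2 \<partial>\<mu> \<partial>\<mu>)"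
      by (subst fubini_continuous(1)[OF compact compact \<mu> \<mu>, symmetric])
         (auto intro!: continuous_intros continuous_on_compose2[OF g])
    also have "\<dots> = (\<integral>s. (g (x + s))\<^sup>2 - 2 * g (x + s) * ?T x + ?T2 x \<partial>\<mu>)"
      using i prob_space unfolding power2_diff translation_average_def
      by (intro Bochner_Integration.integral_cong refl) (simp add: algebra_simps)
    also have "\<dots> = 2 * ?T2 x - 2 * (?T x)\<^sup>2"
      using i prob_space by (simp add: translation_average_def power2_eq_square)
    finally show ?thesis .
  qed
  have "(\<integral>p. increment h g (fst p) (snd p) \<partial>(\<mu> \<Otimes>\<^sub>M \<mu>))
      = (\<integral>x. \<integral>p. ?F (x, p) \<partial>(\<mu> \<Otimes>\<^sub>M \<mu>) \<partial>h)"
    unfolding increment_def using fub(1,2) by simp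
  also have "\<dots> = (\<integral>x. 2 * ?T2 x - 2 * (?T x)\<^sup>2 \<partial>h)" by (simp only: inner)
  also have "\<dots> = 2 * energy h g - 2 * energy h ?T"
    using integral_translation_average[OF \<mu> g2]
      integrable_continuous[OF compact haar_borel_probs, of "\<lambda>x. (?T x)\<^sup>2"] Tg
    by (simp add: energy_def continuous_on_power)
  finally show "(\<integral>p. increment h g (fst p) (snd p) \<partial>(\<mu> \<Otimes>\<^sub>M \<mu>))
      = 2 * energy h g - 2 * energy h ?T" .
qed

lemma energy_translation_average_le:
  fixes g :: "'a \<Rightarrow> real"
  assumes "\<mu> \<in> borel_probs" "continuous_on UNIV g" "continuous_on UNIV (translation_average \<mu> g)"
  shows "energy h (translation_average \<mu> g) \<le> energy h g"
proof -
  have "0 \<le> (\<integral>p. increment h g (fst p) (snd p) \<partial>(\<mu> \<Otimes>\<^sub>M \<mu>))"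
    by (intro integral_nonneg_AE AE_I2 increment_nonneg)
  then show ?thesis using integral_increment(2)[OF assms] by simp
qed

text \<open>
  Averaging against the Haar measure itself kills a function of mean zero, so such a function has
  no more energy than half its largest increment.
\<close>

lemma energy_le_increment:
  fixes g :: "'a \<Rightarrow> real"
  assumes g: "continuous_on UNIV g" "(\<integral>x. g x \<partial>h) = 0" and B: "\<And>s t. increment h g s t \<le> B"
  shows "2 * energy h g \<le> B"
proof -
  interpret P: prob_space "h \<Otimes>\<^sub>M h"
    by (intro borel_probsD(1) pair_measure_borel_probs compact haar_borel_probs)
  have "translation_average h g = (\<lambda>x. 0)"
    unfolding translation_average_def using integral_haar_translate[OF g(1)] g(2)
    by (simp add: add.commute)
  then have "2 * energy h g = (\<integral>p. increment h g (fst p) (snd p) \<partial>(h \<Otimes>\<^sub>M h))"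
    and "integrable (h \<Otimes>\<^sub>M h) (\<lambda>p. increment h g (fst p) (snd p))"
    using integral_increment[OF haar_borel_probs g(1)] by (simp_all add: energy_def)
  then show ?thesis using B by (simp add: P.integral_le_const)
qed

lemma integrable_increment:
  fixes g :: "'a \<Rightarrow> real"
  assumes "continuous_on UNIV g"
  shows "integrable h (\<lambda>x. (g (x + s) - g (x + t))\<^sup>2)"
  by (intro integrable_continuous compact haar_borel_probs continuous_intros
        continuous_on_translate assms)

lemma increment_translate:
  fixes g :: "'a \<Rightarrow> real"
  assumes "continuous_on UNIV g"
  shows "increment h g (s + u) (t + u) = increment h g s t"
proof -
  have "continuous_on UNIV (\<lambda>x. (g (x + s) - g (x + t))\<^sup>2)"
    by (intro continuous_intros continuous_on_translate assms)
  from integral_haar_translate[OF this, of u] show ?thesis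
    by (simp add: increment_def ac_simps)
qed

lemma increment_triangle:
  fixes g :: "'a \<Rightarrow> real"
  assumes "continuous_on UNIV g"
  shows "increment h g s u \<le> 2 * increment h g s t + 2 * increment h g t u"
proof -
  have square: "(a + b)\<^sup>2 \<le> 2 * a\<^sup>2 + 2 * b\<^sup>2" for a b :: real
    using zero_le_power2[of "a - b"] by (simp add: power2_eq_square algebra_simps)
  have "increment h g s u \<le> (\<integral>x. 2 * (g (x + s) - g (x + t))\<^sup>2 + 2 * (g (x + t) - g (x + u))\<^sup>2 \<partial>h)"
    unfolding increment_def
  proof (rule integral_mono)
    show "(g (x + s) - g (x + u))\<^sup>2 \<le> 2 * (g (x + s) - g (x + t))\<^sup>2 + 2 * (g (x + t) - g (x + u))\<^sup>2"
      for x using square[of "g (x + s) - g (x + t)" "g (x + t) - g (x + u)"] by simp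
  qed (intro integrable_increment assms Bochner_Integration.integrable_add integrable_mult_right)+
  then show ?thesis unfolding increment_def using integrable_increment[OF assms] by simp
qed

lemma increment_modulus:
  fixes g :: "'a \<Rightarrow> real"
  assumes g: "continuous_on UNIV g" "has_modulus w g" and e: "w (s - t) \<le> e"
  shows "increment h g s t \<le> e\<^sup>2"
proof -
  interpret prob_space h by (rule borel_probsD(1)[OF haar_borel_probs])
  have "(g (x + s) - g (x + t))\<^sup>2 \<le> e\<^sup>2" for x
  proof -
    have "\<bar>g (x + s) - g (x + t)\<bar> \<le> e"
      using has_modulusD[OF g(2), of "x + t" "s - t"] e by (simp add: algebra_simps)
    then have "\<bar>g (x + s) - g (x + t)\<bar>\<^sup>2 \<le> e\<^sup>2" by (intro power_mono) auto
    then show ?thesis by simp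
  qed
  then show ?thesis
    unfolding increment_def by (intro integral_le_const integrable_increment g AE_I2)
qed

text \<open>
  Where \<open>\<bar>g\<bar>\<close> is at least \<open>e\<close>, the modulus keeps it at least \<open>e / 2\<close> on a translate of a fixed ball
  around \<open>0\<close>, and all translates of that ball have the same positive Haar measure.
\<close>

lemma sup_le_energy:
  fixes w :: "'a \<Rightarrow> real"
  assumes w: "(w \<longlongrightarrow> 0) (nhds 0)" and "e > 0"
  obtains \<eta> where "\<eta> > 0"
    "\<And>g x. has_modulus w g \<Longrightarrow> energy h g < \<eta> \<Longrightarrow> \<bar>g x\<bar> < e"
proof -
  interpret prob_space h by (rule borel_probsD(1)[OF haar_borel_probs])
  note h = borel_probsD(2,3)[OF haar_borel_probs]
  obtain r where r: "r > 0" "\<And>s. s \<in> ball 0 r \<Longrightarrow> w s < e / 2"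
    using modulus_small_ball[OF w, of "e / 2" 0] \<open>e > 0\<close> by auto
  define b where "b = measure h (ball 0 r)"
  have b: "b > 0" unfolding b_def using r(1) by (intro haar_open_pos) auto
  show thesis
  proof (rule that)
    show "b * (e\<^sup>2 / 4) > 0" using b \<open>e > 0\<close> by simp
    fix g :: "'a \<Rightarrow> real" and x assume g: "has_modulus w g" "energy h g < b * (e\<^sup>2 / 4)"
    note cont = has_modulus_continuous[OF w g(1)]
    show "\<bar>g x\<bar> < e"
    proof (rule ccontr)
      assume large: "\<not> \<bar>g x\<bar> < e"
      have i: "integrable h (\<lambda>s. (g (s + x))\<^sup>2)"
        by (intro integrable_continuous compact haar_borel_probs continuous_intros
              continuous_on_translate cont)
      have "b * (e\<^sup>2 / 4) = (\<integral>s. e\<^sup>2 / 4 * indicator (ball 0 r) s \<partial>h)" using h by (simp add: b_def)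
      also have "\<dots> \<le> (\<integral>s. (g (s + x))\<^sup>2 \<partial>h)"
      proof (intro integral_mono i integrable_mult_right integrable_real_indicator)
        show "e\<^sup>2 / 4 * indicator (ball 0 r) s \<le> (g (s + x))\<^sup>2" for s
        proof (cases "s \<in> ball 0 r")
          case True
          have "\<bar>g (s + x)\<bar> \<ge> e / 2"
            using has_modulusD[OF g(1), of x s] r(2)[OF True] large by (simp add: add.commute)
          then have "(e / 2)\<^sup>2 \<le> \<bar>g (s + x)\<bar>\<^sup>2" using \<open>e > 0\<close> by (intro power_mono) auto
          with True show ?thesis by (simp add: power_divide)
        qed simp
      qed (use h in \<open>auto simp: emeasure_eq_measure\<close>)
      also have "\<dots> = energy h g"
        unfolding energy_def by (intro integral_haar_translate continuous_intros cont)
      finally show False using g(2) by simp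
    qed
  qed
qed

end

end

section \<open>Loss of energy under strictly aperiodic measures\<close>

text \<open>
  A bump function supported in the ball turns the positive mass into a weak-* open condition.
\<close>

lemma measure_ball_near_support:
  fixes \<mu> :: "'a::metric_space measure"
  assumes compact: "compact (UNIV :: 'a set)" and \<mu>: "\<mu> \<in> borel_probs" and a: "a \<in> supp \<mu>" and r: "r > 0"
  shows "\<exists>U p. openin weak_star_topology U \<and> \<mu> \<in> U \<and> p > 0 \<and> (\<forall>\<mu>'\<in>U. measure \<mu>' (ball a r) \<ge> p)"
proof -
  interpret prob_space \<mu> by (rule borel_probsD(1)[OF \<mu>])
  note m = borel_probsD(2,3)[OF \<mu>]
  define b where "b x = max 0 (1 - dist a x / r)" for x
  have b: "continuous_on UNIV b" unfolding b_def by (intro continuous_intros) (use r in auto)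
  have "\<not> (closed (- ball a (r / 2)) \<and> measure \<mu> (- ball a (r / 2)) = 1)"
    using a r by (auto simp: supp_def)
  then have "prob (- ball a (r / 2)) \<noteq> 1" by (simp add: closed_Compl)
  then have "prob (ball a (r / 2)) \<noteq> 0"
    using prob_compl[of "ball a (r / 2)"] m by (auto simp: Compl_eq_Diff_UNIV)
  then have "0 < 1 / 2 * prob (ball a (r / 2))" by (simp add: zero_less_measure_iff)
  also have "\<dots> = (\<integral>x. 1 / 2 * indicator (ball a (r / 2)) x \<partial>\<mu>)" using m by simp
  also have "\<dots> \<le> (\<integral>x. b x \<partial>\<mu>)"
    using r m
    by (intro integral_mono integrable_continuous[OF compact \<mu> b] integrable_mult_right
          integrable_real_indicator)
       (auto simp: b_def indicator_def field_simps emeasure_eq_measure)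
  finally have pos: "0 < (\<integral>x. b x \<partial>\<mu>)" .
  define p where "p = (\<integral>x. b x \<partial>\<mu>) / 2"
  define U where "U = {\<mu>' \<in> borel_probs. (\<integral>x. b x \<partial>\<mu>') \<in> {p<..}}"
  have "openin weak_star_topology U"
    unfolding U_def weak_star_topology_def using b
    by (intro topology_generated_by_Basis CollectI exI[of _ b] exI[of _ "{p<..}"]) auto
  moreover have "measure \<mu>' (ball a r) \<ge> p" if "\<mu>' \<in> U" for \<mu>'
  proof -
    have \<mu>': "\<mu>' \<in> borel_probs" using that by (simp add: U_def)
    interpret M': prob_space \<mu>' by (rule borel_probsD(1)[OF \<mu>'])
    note m' = borel_probsD(2,3)[OF \<mu>']
    have "p \<le> (\<integral>x. b x \<partial>\<mu>')" using that by (simp add: U_def)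
    also have "\<dots> \<le> (\<integral>x. indicator (ball a r) x \<partial>\<mu>')"
      using r m'
      by (intro integral_mono integrable_continuous[OF compact \<mu>' b] integrable_real_indicator)
         (auto simp: b_def indicator_def field_simps M'.emeasure_eq_measure)
    also have "\<dots> = measure \<mu>' (ball a r)" using m' by simp
    finally show ?thesis .
  qed
  ultimately show ?thesis using pos \<mu> by (intro exI[of _ U] exI[of _ p]) (auto simp: U_def p_def)
qed

context
  fixes h :: "'a::{metric_space, topological_ab_group_add} measure"
  assumes haar: "haar_probability h" and compact: "compact (UNIV :: 'a set)"
begin

text \<open>
  The root of \<open>u \<mapsto> increment h g u 0\<close> is an \<open>L\<^sup>2\<close> distance between \<open>g\<close> and a translate, hence
  subadditive in \<open>u\<close>. So it is controlled on a generated semigroup by its values on generators; that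
  \<open>C\<close> and \<open>F\<close> do not depend on \<open>g\<close> is what makes the later bounds uniform.
\<close>

lemma increment_hull_bound:
  fixes A :: "'a set"
  assumes "u \<in> add_closed hull {\<alpha> - \<beta> | \<alpha> \<beta>. \<alpha> \<in> A \<and> \<beta> \<in> A}"
  shows "\<exists>C F. C \<ge> 0 \<and> finite F \<and> F \<subseteq> A \<times> A \<and> (\<forall>g. continuous_on UNIV g \<longrightarrow>
    increment h g u 0 \<le> C * (\<Sum>p\<in>F. increment h g (fst p) (snd p)))"
proof -
  define ctrl where "ctrl u C F \<longleftrightarrow> C \<ge> 0 \<and> finite F \<and> F \<subseteq> A \<times> A \<and>
    (\<forall>g. continuous_on UNIV g \<longrightarrow>
      increment h g u 0 \<le> C * (\<Sum>p\<in>F. increment h g (fst p) (snd p)))" for u :: 'a and C F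
  have "add_closed hull {\<alpha> - \<beta> | \<alpha> \<beta>. \<alpha> \<in> A \<and> \<beta> \<in> A} \<subseteq> {u. \<exists>C F. ctrl u C F}"
  proof (rule hull_minimal)
    have "ctrl (\<alpha> - \<beta>) 1 {(\<alpha>, \<beta>)}" if "\<alpha> \<in> A" "\<beta> \<in> A" for \<alpha> \<beta>
      using that increment_translate[OF haar compact, of _ "\<alpha> - \<beta>" \<beta> 0] by (simp add: ctrl_def)
    then show "{\<alpha> - \<beta> | \<alpha> \<beta>. \<alpha> \<in> A \<and> \<beta> \<in> A} \<subseteq> {u. \<exists>C F. ctrl u C F}" by blast
    have "ctrl (u + v) (2 * C + 2 * D) (F \<union> G)" if u: "ctrl u C F" and v: "ctrl v D G" for u v C D F G
    proof -
      have "increment h g (u + v) 0 \<le> (2 * C + 2 * D) * (\<Sum>p\<in>F \<union> G. increment h g (fst p) (snd p))"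
        if g: "continuous_on UNIV g" for g
      proof -
        let ?S = "\<lambda>F. \<Sum>p\<in>F. increment h g (fst p) (snd p)"
        have "increment h g (u + v) 0 \<le> 2 * increment h g (u + v) (0 + v) + 2 * increment h g v 0"
          using increment_triangle[OF haar compact g, of "u + v" 0 v] by simp
        also have "\<dots> = 2 * increment h g u 0 + 2 * increment h g v 0"
          using increment_translate[OF haar compact g, of u v 0] by simp
        also have "\<dots> \<le> 2 * (C * ?S F) + 2 * (D * ?S G)"
          using u v g by (auto simp: ctrl_def intro!: add_mono)
        also have "\<dots> \<le> 2 * (C * ?S (F \<union> G)) + 2 * (D * ?S (F \<union> G))"
          using u v by (auto simp: ctrl_def intro!: add_mono mult_left_mono sum_mono2 increment_nonneg)
        finally show ?thesis by (simp add: algebra_simps)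
      qed
      then show ?thesis using u v by (auto simp: ctrl_def)
    qed
    then show "add_closed {u. \<exists>C F. ctrl u C F}" unfolding add_closed_def by (clarsimp, blast)
  qed
  then show ?thesis using assms unfolding ctrl_def by blast
qed

text \<open>
  Every translation is within the reach of the modulus of one of finitely many elements of the
  dense semigroup.
\<close>

lemma increment_le_support_increments:
  fixes w :: "'a \<Rightarrow> real"
  assumes "strictly_aperiodic \<mu>" and w: "(w \<longlongrightarrow> 0) (nhds 0)" and "\<kappa> > 0"
  obtains C F where "C \<ge> 0" "finite F" "F \<subseteq> supp \<mu> \<times> supp \<mu>"
    "\<And>g s t. has_modulus w g \<Longrightarrow>
      increment h g s t \<le> C * (\<Sum>p\<in>F. increment h g (fst p) (snd p)) + \<kappa>"
proof -
  define H where "H = add_closed hull {\<alpha> - \<beta> | \<alpha> \<beta>. \<alpha> \<in> supp \<mu> \<and> \<beta> \<in> supp \<mu>}"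
  have dense: "closure H = UNIV" using assms(1) by (simp add: strictly_aperiodic_def H_def)
  have "\<forall>u\<in>H. \<exists>C F. C \<ge> 0 \<and> finite F \<and> F \<subseteq> supp \<mu> \<times> supp \<mu> \<and> (\<forall>g. continuous_on UNIV g \<longrightarrow>
      increment h g u 0 \<le> C * (\<Sum>p\<in>F. increment h g (fst p) (snd p)))"
    using increment_hull_bound[of _ "supp \<mu>"] unfolding H_def by blast
  then obtain C F where CF: "\<And>u. u \<in> H \<Longrightarrow> C u \<ge> 0" "\<And>u. u \<in> H \<Longrightarrow> finite (F u)"
    "\<And>u. u \<in> H \<Longrightarrow> F u \<subseteq> supp \<mu> \<times> supp \<mu>"
    "\<And>u g. u \<in> H \<Longrightarrow> continuous_on UNIV g \<Longrightarrow>
      increment h g u 0 \<le> C u * (\<Sum>p\<in>F u. increment h g (fst p) (snd p))"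
    unfolding bchoice_iff by blast
  define q where "q = sqrt (\<kappa> / 2)"
  have q: "q > 0" "q\<^sup>2 = \<kappa> / 2" using \<open>\<kappa> > 0\<close> by (auto simp: q_def)
  obtain r where r: "r > 0" "\<And>s. s \<in> ball 0 r \<Longrightarrow> w s < q"
    using modulus_small_ball[OF w q(1), of 0] by auto
  define V where "V e = (\<lambda>u. u - e) -` ball 0 r" for e :: 'a
  have V: "open (V e)" for e
    unfolding V_def by (intro open_vimage open_ball continuous_intros)
  have "\<exists>e\<in>H. u \<in> V e" for u
  proof -
    let ?O = "(\<lambda>e. u - e) -` ball 0 r"
    have "open ?O" by (intro open_vimage open_ball continuous_intros)
    moreover have "u \<in> ?O" using r(1) by simp
    ultimately have "?O \<inter> H \<noteq> {}"
      using dense open_Int_closure_eq_empty[of ?O H] by (metis Int_UNIV_right empty_iff)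
    then show ?thesis by (auto simp: V_def)
  qed
  then have "UNIV \<subseteq> (\<Union>e\<in>H. V e)" by blast
  then obtain E where E: "E \<subseteq> H" "finite E" "UNIV \<subseteq> (\<Union>e\<in>E. V e)"
    using compactE_image[OF compact, of H V] V by metis
  show thesis
  proof (rule that)
    show "2 * (\<Sum>e\<in>E. C e) \<ge> 0" using E CF(1) by (auto intro!: sum_nonneg)
    show "finite (\<Union>e\<in>E. F e)" "(\<Union>e\<in>E. F e) \<subseteq> supp \<mu> \<times> supp \<mu>" using E CF(2,3) by blast+
    fix g s t assume g: "has_modulus w g"
    note cont = has_modulus_continuous[OF w g]
    let ?S = "\<lambda>F. \<Sum>p\<in>F. increment h g (fst p) (snd p)"
    have S: "0 \<le> ?S F" for F by (intro sum_nonneg increment_nonneg)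
    obtain e where e: "e \<in> E" "s - t \<in> V e" using E(3) by blast
    then have "w (s - t - e) \<le> q" using r(2) by (auto simp: V_def less_imp_le)
    then have close: "increment h g (s - t) e \<le> \<kappa> / 2"
      using increment_modulus[OF haar compact cont g, of "s - t" e q] q(2) by simp
    have "increment h g s t = increment h g (s - t) 0"
      using increment_translate[OF haar compact cont, of "s - t" t 0] by simp
    also have "\<dots> \<le> 2 * increment h g (s - t) e + 2 * increment h g e 0"
      by (rule increment_triangle[OF haar compact cont])
    also have "\<dots> \<le> \<kappa> + 2 * (C e * ?S (F e))"
      using close CF(4)[OF subsetD[OF E(1) e(1)] cont] by simp
    also have "C e * ?S (F e) \<le> (\<Sum>e\<in>E. C e) * ?S (\<Union>e\<in>E. F e)"
    proof (rule mult_mono)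
      show "C e \<le> (\<Sum>e\<in>E. C e)" using e E CF(1) by (intro member_le_sum) auto
      show "?S (F e) \<le> ?S (\<Union>e\<in>E. F e)"
        using e E CF(2) by (intro sum_mono2 increment_nonneg) auto
      show "0 \<le> (\<Sum>e\<in>E. C e)" using E CF(1) by (intro sum_nonneg) auto
    qed (rule S)
    finally show "increment h g s t \<le> 2 * (\<Sum>e\<in>E. C e) * ?S (\<Union>e\<in>E. F e) + \<kappa>" by simp
  qed
qed

text \<open>
  By the modulus, \<open>increment h g \<alpha> \<beta>\<close> is at most \<open>4 * increment h g s t + 6 * e\<^sup>2\<close> for all \<open>s\<close>, \<open>t\<close>
  in the two balls. These fill a proportion of at least \<open>p\<^sup>2\<close> of the pairs, and the increment
  averaged over all pairs is twice the energy lost.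
\<close>

lemma increment_le_energy_loss:
  fixes \<mu> :: "'a measure"
  assumes \<mu>: "\<mu> \<in> borel_probs" and w: "(w \<longlongrightarrow> 0) (nhds 0)" "has_modulus w g" and "p > 0"
    and \<alpha>: "\<And>s. s \<in> ball \<alpha> r \<Longrightarrow> w (s - \<alpha>) \<le> e" "measure \<mu> (ball \<alpha> r) \<ge> p"
    and \<beta>: "\<And>s. s \<in> ball \<beta> r' \<Longrightarrow> w (s - \<beta>) \<le> e" "measure \<mu> (ball \<beta> r') \<ge> p"
  shows "increment h g \<alpha> \<beta> \<le> 6 * e\<^sup>2 + 8 * (energy h g - energy h (translation_average \<mu> g)) / p\<^sup>2"
proof -
  interpret prob_space \<mu> by (rule borel_probsD(1)[OF \<mu>])
  have P: "\<mu> \<Otimes>\<^sub>M \<mu> \<in> borel_probs" by (intro pair_measure_borel_probs compact \<mu>)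
  interpret P: prob_space "\<mu> \<Otimes>\<^sub>M \<mu>" by (rule borel_probsD(1)[OF P])
  note m = borel_probsD(2,3)[OF \<mu>]
  note cont = has_modulus_continuous[OF w]
  note Tcont = has_modulus_continuous[OF w(1) has_modulus_translation_average[OF compact \<mu> w(2) cont]]
  note loss = integral_increment[OF haar compact \<mu> cont Tcont]
  let ?I = "\<lambda>p. increment h g (fst p) (snd p)"
  define D where "D = increment h g \<alpha> \<beta> - 6 * e\<^sup>2"
  let ?R = "ball \<alpha> r \<times> ball \<beta> r'"
  have R: "?R \<in> sets (\<mu> \<Otimes>\<^sub>M \<mu>)" using m by auto
  have near: "D \<le> 4 * increment h g s t" if "s \<in> ball \<alpha> r" "t \<in> ball \<beta> r'" for s t
    using increment_triangle[OF haar compact cont, of \<alpha> \<beta> s]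
      increment_triangle[OF haar compact cont, of s \<beta> t]
      increment_modulus[OF haar compact cont w(2) \<alpha>(1)[OF that(1)]]
      increment_modulus[OF haar compact cont w(2) \<beta>(1)[OF that(2)]]
      increment_commute[of h g \<alpha> s]
    by (simp add: D_def)
  have loss_nonneg: "0 \<le> energy h g - energy h (translation_average \<mu> g)"
    using energy_translation_average_le[OF haar compact \<mu> cont Tcont] by simp
  have "D * p\<^sup>2 \<le> 8 * (energy h g - energy h (translation_average \<mu> g))"
  proof (cases "D \<ge> 0")
    case True
    have "D * p\<^sup>2 \<le> D * (measure \<mu> (ball \<alpha> r) * measure \<mu> (ball \<beta> r'))"
      using True \<alpha>(2) \<beta>(2) \<open>p > 0\<close>
      unfolding power2_eq_square by (intro mult_left_mono mult_mono) linarith+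
    also have "\<dots> = (\<integral>q. D * indicator ?R q \<partial>(\<mu> \<Otimes>\<^sub>M \<mu>))"
      using R m borel_probsD(3)[OF P]
      by (simp add: measure_def emeasure_pair_measure_Times enn2real_mult)
    also have "\<dots> \<le> (\<integral>q. 4 * ?I q \<partial>(\<mu> \<Otimes>\<^sub>M \<mu>))"
    proof (intro integral_mono integrable_mult_right integrable_real_indicator loss(1) R)
      show "D * indicator ?R q \<le> 4 * ?I q" for q
      proof (cases "q \<in> ?R")
        case True
        then have "D \<le> 4 * ?I q" by (intro near) (simp_all only: mem_Times_iff)
        with True show ?thesis by simp
      next
        case False
        then show ?thesis using increment_nonneg[of h g "fst q" "snd q"] by simp
      qed
    qed (simp add: P.emeasure_eq_measure)
    also have "\<dots> = 8 * (energy h g - energy h (translation_average \<mu> g))"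
      using loss(2) by simp
    finally show ?thesis .
  next
    case False
    then have "D * p\<^sup>2 \<le> 0" by (simp add: mult_nonpos_nonneg)
    also have "0 \<le> 8 * (energy h g - energy h (translation_average \<mu> g))"
      using loss_nonneg by simp
    finally show ?thesis .
  qed
  then show ?thesis using \<open>p > 0\<close> by (simp add: D_def field_simps)
qed

end

section \<open>Equidistribution uniformly over a weak-* compact set\<close>

text \<open>
  One constant \<open>c\<close> has to serve all functions with the given modulus, because the function to which
  \<open>\<mu>\<close> is applied changes along the walk.
\<close>

definition loses_energy :: "'a::plus measure \<Rightarrow> ('a \<Rightarrow> real) \<Rightarrow> real \<Rightarrow> real \<Rightarrow> 'a measure \<Rightarrow> bool" where
  "loses_energy h w \<eta> c \<mu> \<longleftrightarrow> (\<forall>g. has_modulus w g \<longrightarrow> (\<integral>x. g x \<partial>h) = 0 \<longrightarrow> energy h g \<ge> \<eta> \<longrightarrow>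
    energy h (translation_average \<mu> g) \<le> energy h g - c)"

lemma loses_energyD:
  assumes "loses_energy h w \<eta> c \<mu>" "has_modulus w g" "(\<integral>x. g x \<partial>h) = 0" "\<eta> \<le> energy h g"
  shows "energy h (translation_average \<mu> g) \<le> energy h g - c"
  using assms unfolding loses_energy_def by blast

context
  fixes h :: "'a::{metric_space, topological_ab_group_add} measure"
  assumes haar: "haar_probability h" and compact: "compact (UNIV :: 'a set)"
begin

text \<open>
  The open set asks for mass near the finitely many support points that control all increments of
  functions with modulus \<open>w\<close>. A function of mean zero with energy at least \<open>\<eta>\<close> has a large
  increment, hence a large increment between two of these points, hence loses energy.
\<close>

lemma energy_loss_nhd:
  fixes w :: "'a \<Rightarrow> real" and \<mu> :: "'a measure"
  assumes \<mu>: "\<mu> \<in> borel_probs" "strictly_aperiodic \<mu>" and w: "(w \<longlongrightarrow> 0) (nhds 0)" and "\<eta> > 0"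
  obtains U c where "openin weak_star_topology U" "\<mu> \<in> U" "c > 0"
    "\<forall>\<mu>'\<in>U. loses_energy h w \<eta> c \<mu>'"
proof -
  obtain C F where CF: "C \<ge> 0" "finite F" "F \<subseteq> supp \<mu> \<times> supp \<mu>"
    "\<And>g s t. has_modulus w g \<Longrightarrow>
      increment h g s t \<le> C * (\<Sum>p\<in>F. increment h g (fst p) (snd p)) + \<eta> / 2"
    using increment_le_support_increments[OF haar compact \<mu>(2) w, of "\<eta> / 2"] \<open>\<eta> > 0\<close> by auto
  \<comment> \<open>The summand \<open>1\<close> only makes \<open>N\<close> positive. With the radii below, the error \<open>6 * e\<^sup>2\<close> made at
    each pair in \<open>F\<close> adds up, weighted by \<open>C\<close>, to at most \<open>\<eta> / 2\<close>; the error of the reduction to \<open>F\<close> is the other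
    half of \<open>\<eta>\<close>, against \<open>2 * energy h g \<ge> 2 * \<eta>\<close>.\<close>
  define N where "N = C * card F + 1"
  have N: "N > 0" using CF(1) by (simp add: N_def add_nonneg_pos)
  define e where "e = sqrt (\<eta> / (12 * N))"
  have e: "e > 0" "6 * e\<^sup>2 * N = \<eta> / 2" using N \<open>\<eta> > 0\<close> by (auto simp: e_def)
  have "\<exists>r>0. \<forall>s\<in>ball a r. w (s - a) < e" for a
    using modulus_small_ball[OF w e(1), of a] by metis
  then obtain r where r: "\<And>a. r a > 0" "\<And>a s. s \<in> ball a (r a) \<Longrightarrow> w (s - a) < e" by metis
  define D where "D = fst ` F \<union> snd ` F"
  have D: "finite D" "D \<subseteq> supp \<mu>" using CF(2,3) by (auto simp: D_def)
  have "\<forall>a\<in>D. \<exists>U p. openin weak_star_topology U \<and> \<mu> \<in> U \<and> p > 0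
      \<and> (\<forall>\<mu>'\<in>U. measure \<mu>' (ball a (r a)) \<ge> p)"
    using measure_ball_near_support[OF compact \<mu>(1)] r(1) D(2) by blast
  then obtain V p where V: "\<And>a. a \<in> D \<Longrightarrow> openin weak_star_topology (V a)"
    "\<And>a. a \<in> D \<Longrightarrow> \<mu> \<in> V a" "\<And>a. a \<in> D \<Longrightarrow> p a > 0"
    "\<And>a \<mu>'. a \<in> D \<Longrightarrow> \<mu>' \<in> V a \<Longrightarrow> measure \<mu>' (ball a (r a)) \<ge> p a"
    unfolding bchoice_iff by blast
  \<comment> \<open>The \<open>1\<close> keeps the minimum defined when there are no points to consider.\<close>
  define q where "q = Min (insert 1 (p ` D))"
  have q: "q > 0" "\<And>a. a \<in> D \<Longrightarrow> q \<le> p a" using D(1) V(3) by (auto simp: q_def)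
  define U where "U = (\<Inter>a\<in>D. V a) \<inter> topspace weak_star_topology"
  show thesis
  proof (rule that)
    show "openin weak_star_topology U" unfolding U_def using D(1) V(1) by (rule openin_INT)
    show "\<mu> \<in> U" using V(2) \<mu>(1) by (simp add: U_def)
    show "\<eta> * q\<^sup>2 / (8 * N) > 0" using N q(1) \<open>\<eta> > 0\<close> by simp
    show "\<forall>\<mu>'\<in>U. loses_energy h w \<eta> (\<eta> * q\<^sup>2 / (8 * N)) \<mu>'"
      unfolding loses_energy_def
    proof (intro ballI allI impI)
      fix \<mu>' g assume \<mu>': "\<mu>' \<in> U" and g: "has_modulus w g" "(\<integral>x. g x \<partial>h) = 0" "energy h g \<ge> \<eta>"
      define L where "L = energy h g - energy h (translation_average \<mu>' g)"
      have P: "\<mu>' \<in> borel_probs" using \<mu>' by (simp add: U_def)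
      note cont = has_modulus_continuous[OF w g(1)]
      note Tcont = has_modulus_continuous[OF w has_modulus_translation_average[OF compact P g(1) cont]]
      have L: "L \<ge> 0" using energy_translation_average_le[OF haar compact P cont Tcont] by (simp add: L_def)
      have mass: "q \<le> measure \<mu>' (ball a (r a))" if "a \<in> D" for a
      proof -
        have "\<mu>' \<in> V a" using \<mu>' that by (simp add: U_def)
        then show ?thesis using V(4)[OF that] q(2)[OF that] by (meson order_trans)
      qed
      have bd: "increment h g (fst x) (snd x) \<le> 6 * e\<^sup>2 + 8 * L / q\<^sup>2" if "x \<in> F" for x
        unfolding L_def
      proof (rule increment_le_energy_loss[OF haar compact P w g(1) q(1)])
        show "q \<le> measure \<mu>' (ball (fst x) (r (fst x)))" "q \<le> measure \<mu>' (ball (snd x) (r (snd x)))"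
          using that by (auto intro!: mass simp: D_def)
      qed (use r(2) in \<open>auto intro: less_imp_le simp del: mem_ball\<close>)
      have "2 * energy h g \<le> C * (\<Sum>x\<in>F. increment h g (fst x) (snd x)) + \<eta> / 2"
        by (intro energy_le_increment[OF haar compact cont g(2)] CF(4) g(1))
      also have "\<dots> \<le> C * (card F * (6 * e\<^sup>2 + 8 * L / q\<^sup>2)) + \<eta> / 2"
        using CF(1) bd by (intro add_mono mult_left_mono sum_bounded_above) auto
      also have "\<dots> = (C * card F) * (6 * e\<^sup>2 + 8 * L / q\<^sup>2) + \<eta> / 2" by simp
      also have "\<dots> \<le> N * (6 * e\<^sup>2 + 8 * L / q\<^sup>2) + \<eta> / 2"
        using L by (intro add_mono mult_right_mono) (auto simp: N_def)
      also have "\<dots> = \<eta> + 8 * N * L / q\<^sup>2" using e(2) by (simp add: algebra_simps)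
      finally have "\<eta> \<le> 8 * N * L / q\<^sup>2" using g(3) by simp
      then have "\<eta> * q\<^sup>2 / (8 * N) \<le> L" using N q(1) by (simp add: field_simps)
      then show "energy h (translation_average \<mu>' g) \<le> energy h g - \<eta> * q\<^sup>2 / (8 * N)"
        by (simp add: L_def)
    qed
  qed
qed

lemma energy_loss_uniform:
  fixes w :: "'a \<Rightarrow> real" and K :: "'a measure set"
  assumes K: "compactin weak_star_topology K" "\<forall>\<mu>\<in>K. strictly_aperiodic \<mu>"
    and w: "(w \<longlongrightarrow> 0) (nhds 0)" and "\<eta> > 0"
  obtains c where "c > 0" "\<forall>\<mu>\<in>K. loses_energy h w \<eta> c \<mu>"
proof -
  define \<U> where
    "\<U> = {U. openin weak_star_topology U \<and> (\<exists>c>0. \<forall>\<mu>\<in>U. loses_energy h w \<eta> c \<mu>)}"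
  have "K \<subseteq> \<Union>\<U>"
  proof
    fix \<mu> assume \<mu>: "\<mu> \<in> K"
    then have "\<mu> \<in> borel_probs" using compactin_subset_topspace[OF K(1)] by auto
    from energy_loss_nhd[OF this bspec[OF K(2) \<mu>] w \<open>\<eta> > 0\<close>]
    obtain U c where "openin weak_star_topology U" "\<mu> \<in> U" "c > 0"
      "\<forall>\<mu>'\<in>U. loses_energy h w \<eta> c \<mu>'" .
    then show "\<mu> \<in> \<Union>\<U>" unfolding \<U>_def by blast
  qed
  moreover have "openin weak_star_topology U" if "U \<in> \<U>" for U using that by (simp add: \<U>_def)
  ultimately have "\<exists>\<F>. finite \<F> \<and> \<F> \<subseteq> \<U> \<and> K \<subseteq> \<Union>\<F>" by (intro compactinD[OF K(1)])
  then obtain \<F> where \<F>: "finite \<F>" "\<F> \<subseteq> \<U>" "K \<subseteq> \<Union>\<F>" by blast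
  then have "\<forall>U\<in>\<F>. \<exists>c. c > 0 \<and> (\<forall>\<mu>\<in>U. loses_energy h w \<eta> c \<mu>)" unfolding \<U>_def by blast
  then obtain c where c: "\<And>U. U \<in> \<F> \<Longrightarrow> c U > 0"
      "\<And>U \<mu>. U \<in> \<F> \<Longrightarrow> \<mu> \<in> U \<Longrightarrow> loses_energy h w \<eta> (c U) \<mu>"
    unfolding bchoice_iff by blast
  define d where "d = Min (insert 1 (c ` \<F>))"
  have d: "d > 0" "\<And>U. U \<in> \<F> \<Longrightarrow> d \<le> c U" using \<F>(1) c(1) by (auto simp: d_def)
  have "loses_energy h w \<eta> d \<mu>" if "\<mu> \<in> K" for \<mu>
  proof -
    obtain U where U: "U \<in> \<F>" "\<mu> \<in> U" using \<F>(3) \<open>\<mu> \<in> K\<close> by blast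
    show ?thesis
      unfolding loses_energy_def
    proof (intro allI impI)
      fix g assume "has_modulus w g" "(\<integral>x. g x \<partial>h) = 0" "\<eta> \<le> energy h g"
      then have "energy h (translation_average \<mu> g) \<le> energy h g - c U"
        by (rule loses_energyD[OF c(2)[OF U]])
      then show "energy h (translation_average \<mu> g) \<le> energy h g - d" using d(2)[OF U(1)] by linarith
    qed
  qed
  with d(1) show thesis using that by blast
qed

lemma energy_decay:
  fixes w :: "'a \<Rightarrow> real" and K :: "'a measure set"
  assumes K: "K \<subseteq> borel_probs" and w: "(w \<longlongrightarrow> 0) (nhds 0)"
    and loss: "\<forall>\<mu>\<in>K. loses_energy h w \<eta> c \<mu>"
    and f: "has_modulus w f" "(\<integral>x. f x \<partial>h) = 0"
    and "set ms \<subseteq> K"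
  defines "g \<equiv> foldr translation_average ms f"
  shows "has_modulus w g \<and> (\<integral>x. g x \<partial>h) = 0 \<and>
    (energy h g < \<eta> \<or> energy h g \<le> energy h f - c * length ms)"
  using \<open>set ms \<subseteq> K\<close> unfolding g_def
proof (induction ms)
  case Nil
  then show ?case using f by simp
next
  case (Cons \<mu> ms)
  define g where "g = foldr translation_average ms f"
  have g: "has_modulus w g" "(\<integral>x. g x \<partial>h) = 0"
      "energy h g < \<eta> \<or> energy h g \<le> energy h f - c * length ms"
    and \<mu>: "\<mu> \<in> K" "\<mu> \<in> borel_probs"
    using Cons K by (auto simp: g_def)
  note cont = has_modulus_continuous[OF w g(1)]
  have Tg: "has_modulus w (translation_average \<mu> g)"
    by (rule has_modulus_translation_average[OF compact \<mu>(2) g(1) cont])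
  have "energy h (translation_average \<mu> g) \<le> energy h g"
    by (intro energy_translation_average_le[OF haar compact] \<mu>(2) cont has_modulus_continuous[OF w Tg])
  moreover have "energy h (translation_average \<mu> g) \<le> energy h g - c" if "energy h g \<ge> \<eta>"
    by (rule loses_energyD[OF bspec[OF loss \<mu>(1)] g(1,2) that])
  ultimately have "energy h (translation_average \<mu> g) < \<eta> \<or>
      energy h (translation_average \<mu> g) \<le> energy h f - c * length (\<mu> # ms)"
    using g(3) by (cases "energy h g < \<eta>") (auto simp: algebra_simps)
  then show ?case
    using Tg integral_translation_average(2)[OF haar compact \<mu>(2) cont] g(2) by (simp add: g_def)
qed

text \<open>
  Energy stays nonnegative, so it cannot drop by \<open>c\<close> arbitrarily often: after a number of steps that
  depends on \<open>f\<close> and \<open>c\<close> alone, that of the centred function is below \<open>\<eta>\<close>. By the modulus, the averaged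
  function is then uniformly close to the mean of \<open>f\<close>, whatever the starting measure.
\<close>

lemma uniform_equidistribution:
  fixes f :: "'a \<Rightarrow> real" and K :: "'a measure set"
  assumes K: "compactin weak_star_topology K" "\<forall>\<mu>\<in>K. strictly_aperiodic \<mu>"
    and f: "continuous_on UNIV f" and "e > 0"
  shows "\<exists>n. \<forall>ms \<nu>. set ms \<subseteq> K \<longrightarrow> length ms \<ge> n \<longrightarrow> \<nu> \<in> borel_probs \<longrightarrow>
    \<bar>(\<integral>x. f x \<partial>fold conv ms \<nu>) - (\<integral>x. f x \<partial>h)\<bar> \<le> e"
proof -
  interpret H: prob_space h by (rule borel_probsD(1)[OF haar_borel_probs[OF haar]])
  define f0 where "f0 x = f x - (\<integral>x. f x \<partial>h)" for x
  have f0: "continuous_on UNIV f0" unfolding f0_def by (intro continuous_intros f)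
  have mean: "(\<integral>x. f0 x \<partial>h) = 0"
    unfolding f0_def
    using integrable_continuous[OF compact haar_borel_probs[OF haar] f] H.prob_space by simp
  obtain w where w: "(w \<longlongrightarrow> 0) (nhds 0)" "has_modulus w f0"
    by (rule exists_modulus[OF compact f0])
  obtain \<eta> where \<eta>: "\<eta> > 0" "\<And>g x. has_modulus w g \<Longrightarrow> energy h g < \<eta> \<Longrightarrow> \<bar>g x\<bar> < e"
    by (rule sup_le_energy[OF haar compact w(1) \<open>e > 0\<close>]) (rule that)
  obtain c where c: "c > 0" "\<forall>\<mu>\<in>K. loses_energy h w \<eta> c \<mu>"
    by (rule energy_loss_uniform[OF K w(1) \<eta>(1)])
  obtain n :: nat where n: "energy h f0 < n * c" using ex_less_of_nat_mult[OF c(1)] by blast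
  have KP: "K \<subseteq> borel_probs" using compactin_subset_topspace[OF K(1)] by simp
  show ?thesis
  proof (intro exI allI impI)
    fix ms and \<nu> :: "'a measure" assume ms: "set ms \<subseteq> K" "n \<le> length ms" and \<nu>: "\<nu> \<in> borel_probs"
    define g where "g = foldr translation_average ms f0"
    have g: "has_modulus w g" "energy h g < \<eta> \<or> energy h g \<le> energy h f0 - c * length ms"
      using energy_decay[OF KP w(1) c(2) w(2) mean ms(1)] by (auto simp: g_def)
    have "n * c \<le> c * length ms" using ms(2) c(1) by (simp add: mult.commute)
    then have "energy h g < \<eta>" using g(2) n energy_nonneg[of h g] by linarith
    then have small: "\<bar>g x\<bar> < e" for x using \<eta>(2)[OF g(1)] by blast
    interpret N: prob_space \<nu> by (rule borel_probsD(1)[OF \<nu>])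
    have walk: "fold conv ms \<nu> \<in> borel_probs" "(\<integral>x. f0 x \<partial>fold conv ms \<nu>) = (\<integral>x. g x \<partial>\<nu>)"
      using integral_fold_conv[OF compact _ \<nu> w, of ms] ms(1) KP by (auto simp: g_def)
    interpret W: prob_space "fold conv ms \<nu>" by (rule borel_probsD(1)[OF walk(1)])
    have centred: "(\<integral>x. f0 x \<partial>fold conv ms \<nu>) = (\<integral>x. f x \<partial>fold conv ms \<nu>) - (\<integral>x. f x \<partial>h)"
      unfolding f0_def using integrable_continuous[OF compact walk(1) f] W.prob_space by simp
    have ig: "integrable \<nu> g"
      by (intro integrable_continuous compact \<nu> has_modulus_continuous[OF w(1) g(1)])
    have "\<bar>g x\<bar> \<le> e" for x using small by (rule less_imp_le)
    then have bound: "(\<integral>x. g x \<partial>\<nu>) \<le> e" "- e \<le> (\<integral>x. g x \<partial>\<nu>)"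
      using ig by (auto intro!: N.integral_le_const N.integral_ge_const simp: abs_le_iff minus_le_iff)
    show "\<bar>(\<integral>x. f x \<partial>fold conv ms \<nu>) - (\<integral>x. f x \<partial>h)\<bar> \<le> e"
      using walk(2) centred bound by linarith
  qed
qed

end

section \<open>From test functions to the Wasserstein distance\<close>

lemma distr_fst_density:
  fixes \<rho> :: "'a::topological_space measure" and \<sigma> :: "'b::topological_space measure"
  assumes \<rho>: "\<rho> \<in> borel_probs" and \<sigma>: "\<sigma> \<in> borel_probs"
    and G: "G \<in> borel_measurable (\<rho> \<Otimes>\<^sub>M \<sigma>)" "\<And>x. (\<integral>\<^sup>+y. G (x, y) \<partial>\<sigma>) = 1"
  shows "distr (density (\<rho> \<Otimes>\<^sub>M \<sigma>) G) borel fst = \<rho>"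
proof (rule measure_eqI)
  interpret M: prob_space \<rho> by (rule borel_probsD(1)[OF \<rho>])
  interpret N: prob_space \<sigma> by (rule borel_probsD(1)[OF \<sigma>])
  note r = borel_probsD(2,3)[OF \<rho>] and s = borel_probsD(2,3)[OF \<sigma>]
  show "sets (distr (density (\<rho> \<Otimes>\<^sub>M \<sigma>) G) borel fst) = sets \<rho>" using r by simp
  fix B assume "B \<in> sets (distr (density (\<rho> \<Otimes>\<^sub>M \<sigma>) G) borel fst)"
  then have B: "B \<in> sets \<rho>" using r by simp
  have fst: "fst \<in> \<rho> \<Otimes>\<^sub>M \<sigma> \<rightarrow>\<^sub>M borel" using measurable_fst r(1) by (simp cong: measurable_cong_sets)
  have eq: "fst -` B \<inter> space (\<rho> \<Otimes>\<^sub>M \<sigma>) = B \<times> UNIV" using r s by (auto simp: space_pair_measure)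
  have BU: "B \<times> UNIV \<in> sets (\<rho> \<Otimes>\<^sub>M \<sigma>)" using B s by (metis pair_measureI sets.top)
  have "emeasure (distr (density (\<rho> \<Otimes>\<^sub>M \<sigma>) G) borel fst) B = (\<integral>\<^sup>+p. G p * indicator (B \<times> UNIV) p \<partial>(\<rho> \<Otimes>\<^sub>M \<sigma>))"
    using B r fst eq G(1) BU by (simp add: emeasure_distr emeasure_density)
  also have "\<dots> = (\<integral>\<^sup>+x. \<integral>\<^sup>+y. G (x, y) * indicator (B \<times> UNIV) (x, y) \<partial>\<sigma> \<partial>\<rho>)"
    using G(1) BU by (intro N.nn_integral_fst[symmetric]) simp
  also have "\<dots> = (\<integral>\<^sup>+x. \<integral>\<^sup>+y. G (x, y) * indicator B x \<partial>\<sigma> \<partial>\<rho>)"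
    by (simp add: indicator_def)
  also have "\<dots> = (\<integral>\<^sup>+x. indicator B x \<partial>\<rho>)"
    using r(2) by (simp add: nn_integral_multc[OF measurable_compose[OF measurable_Pair1' G(1)]] G(2))
  also have "\<dots> = emeasure \<rho> B" using B by simp
  finally show "emeasure (distr (density (\<rho> \<Otimes>\<^sub>M \<sigma>) G) borel fst) B = emeasure \<rho> B" .
qed

lemma distr_snd_density:
  fixes \<rho> :: "'a::topological_space measure" and \<sigma> :: "'b::topological_space measure"
  assumes \<rho>: "\<rho> \<in> borel_probs" and \<sigma>: "\<sigma> \<in> borel_probs"
    and G: "G \<in> borel_measurable (\<rho> \<Otimes>\<^sub>M \<sigma>)" "\<And>y. (\<integral>\<^sup>+x. G (x, y) \<partial>\<rho>) = 1"
  shows "distr (density (\<rho> \<Otimes>\<^sub>M \<sigma>) G) borel snd = \<sigma>"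
proof (rule measure_eqI)
  interpret M: prob_space \<rho> by (rule borel_probsD(1)[OF \<rho>])
  interpret N: prob_space \<sigma> by (rule borel_probsD(1)[OF \<sigma>])
  interpret pair_prob_space \<rho> \<sigma> ..
  note r = borel_probsD(2,3)[OF \<rho>] and s = borel_probsD(2,3)[OF \<sigma>]
  show "sets (distr (density (\<rho> \<Otimes>\<^sub>M \<sigma>) G) borel snd) = sets \<sigma>" using s by simp
  fix B assume "B \<in> sets (distr (density (\<rho> \<Otimes>\<^sub>M \<sigma>) G) borel snd)"
  then have B: "B \<in> sets \<sigma>" using s by simp
  have snd: "snd \<in> \<rho> \<Otimes>\<^sub>M \<sigma> \<rightarrow>\<^sub>M borel" using measurable_snd s(1) by (simp cong: measurable_cong_sets)
  have eq: "snd -` B \<inter> space (\<rho> \<Otimes>\<^sub>M \<sigma>) = UNIV \<times> B" using r s by (auto simp: space_pair_measure)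
  have BU: "UNIV \<times> B \<in> sets (\<rho> \<Otimes>\<^sub>M \<sigma>)" using B r by (metis pair_measureI sets.top)
  have "emeasure (distr (density (\<rho> \<Otimes>\<^sub>M \<sigma>) G) borel snd) B = (\<integral>\<^sup>+p. G p * indicator (UNIV \<times> B) p \<partial>(\<rho> \<Otimes>\<^sub>M \<sigma>))"
    using B s snd eq G(1) BU by (simp add: emeasure_distr emeasure_density)
  also have "\<dots> = (\<integral>\<^sup>+y. \<integral>\<^sup>+x. G (x, y) * indicator (UNIV \<times> B) (x, y) \<partial>\<rho> \<partial>\<sigma>)"
    using G(1) BU by (intro nn_integral_snd[symmetric, of "\<lambda>p. G p * indicator (UNIV \<times> B) p", simplified]) simp
  also have "\<dots> = (\<integral>\<^sup>+y. \<integral>\<^sup>+x. G (x, y) * indicator B y \<partial>\<rho> \<partial>\<sigma>)"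
    by (simp add: indicator_def)
  also have "\<dots> = (\<integral>\<^sup>+y. indicator B y \<partial>\<sigma>)"
    using s(2) by (simp add: nn_integral_multc[OF measurable_compose[OF measurable_Pair2' G(1)]] G(2))
  also have "\<dots> = emeasure \<sigma> B" using B by simp
  finally show "emeasure (distr (density (\<rho> \<Otimes>\<^sub>M \<sigma>) G) borel snd) B = emeasure \<sigma> B" .
qed

text \<open>
  Since \<open>\<rho>\<close> gives each \<open>\<phi> i\<close> at least \<open>1 - \<theta>\<close> of the weight \<open>b i\<close> that it has under \<open>\<sigma>\<close>, that much
  mass can be moved inside the piece \<open>i\<close>, at cost at most \<open>\<delta>\<close>; the density \<open>R\<close> of what is left over
  from \<open>\<rho>\<close> has mass \<open>\<theta>\<close> and is moved independently, at cost at most \<open>D\<close>.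
\<close>

lemma wasserstein_le_partition:
  fixes \<rho> \<sigma> :: "'a::metric_space measure" and \<phi> :: "'i \<Rightarrow> 'a \<Rightarrow> real"
  assumes compact: "compact (UNIV :: 'a set)" and \<rho>: "\<rho> \<in> borel_probs" and \<sigma>: "\<sigma> \<in> borel_probs"
    and "finite I"
    and \<phi>: "\<And>i. i \<in> I \<Longrightarrow> continuous_on UNIV (\<phi> i)" "\<And>i x. i \<in> I \<Longrightarrow> 0 \<le> \<phi> i x"
      "\<And>x. (\<Sum>i\<in>I. \<phi> i x) = 1"
    and \<delta>: "0 \<le> \<delta>" "\<And>i x y. i \<in> I \<Longrightarrow> 0 < \<phi> i x \<Longrightarrow> 0 < \<phi> i y \<Longrightarrow> dist x y \<le> \<delta>"
    and D: "\<And>x y :: 'a. dist x y \<le> D"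
    and \<theta>: "\<theta> < 1" "\<And>i. i \<in> I \<Longrightarrow> 0 < (\<integral>x. \<phi> i x \<partial>\<sigma>)"
      "\<And>i. i \<in> I \<Longrightarrow> (1 - \<theta>) * (\<integral>x. \<phi> i x \<partial>\<sigma>) \<le> (\<integral>x. \<phi> i x \<partial>\<rho>)"
  shows "wasserstein \<rho> \<sigma> \<le> ennreal (\<delta> + D * \<theta>)"
proof -
  interpret M: prob_space \<rho> by (rule borel_probsD(1)[OF \<rho>])
  interpret N: prob_space \<sigma> by (rule borel_probsD(1)[OF \<sigma>])
  have P: "\<rho> \<Otimes>\<^sub>M \<sigma> \<in> borel_probs" by (intro pair_measure_borel_probs compact \<rho> \<sigma>)
  interpret P: prob_space "\<rho> \<Otimes>\<^sub>M \<sigma>" by (rule borel_probsD(1)[OF P])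
  note int = integrable_continuous[OF compact]
  note cprod = compact_UNIV_prod[OF compact compact]
  define a b where "a i = (\<integral>x. \<phi> i x \<partial>\<rho>)" and "b i = (\<integral>x. \<phi> i x \<partial>\<sigma>)" for i
  have b: "0 < b i" "(1 - \<theta>) * b i \<le> a i" if "i \<in> I" for i
    using \<theta>(2,3)[OF that] by (auto simp: a_def b_def)
  have a: "0 < a i" if "i \<in> I" for i
    using b[OF that] \<theta>(1) mult_pos_pos[of "1 - \<theta>" "b i"] by linarith
  have sum_b: "(\<Sum>i\<in>I. b i) = 1"
  proof -
    have "(\<Sum>i\<in>I. b i) = (\<integral>x. (\<Sum>i\<in>I. \<phi> i x) \<partial>\<sigma>)"
      unfolding b_def using int[OF \<sigma> \<phi>(1)] by (intro Bochner_Integration.integral_sum[symmetric])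
    then show ?thesis using \<phi>(3) N.prob_space by simp
  qed
  define R where "R x = 1 - (1 - \<theta>) * (\<Sum>i\<in>I. b i / a i * \<phi> i x)" for x
  define Q where "Q p = (\<Sum>i\<in>I. (1 - \<theta>) / a i * (\<phi> i (fst p) * \<phi> i (snd p)))" for p
  \<comment> \<open>\<open>R\<close> carries no factor in the second coordinate: under \<open>\<rho> \<Otimes>\<^sub>M \<sigma>\<close> that coordinate
    has law \<open>\<sigma>\<close> and is independent of the first. The part \<open>Q\<close> has second marginal \<open>(1 - \<theta>) \<sigma>\<close>, so the marginals of \<open>G\<close> are exactly \<open>\<rho>\<close> and \<open>\<sigma>\<close>.\<close>
  define G where "G p = Q p + R (fst p)" for p
  have R_nonneg: "0 \<le> R x" for x
  proof -
    have "(1 - \<theta>) * (\<Sum>i\<in>I. b i / a i * \<phi> i x) = (\<Sum>i\<in>I. (1 - \<theta>) * b i / a i * \<phi> i x)"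
      unfolding sum_distrib_left by (intro sum.cong refl) simp
    also have "\<dots> \<le> (\<Sum>i\<in>I. 1 * \<phi> i x)"
      using a b \<phi>(2) by (intro sum_mono mult_right_mono) auto
    finally show ?thesis using \<phi>(3) by (simp add: R_def)
  qed
  have Q_nonneg: "0 \<le> Q p" for p
    unfolding Q_def using a \<theta>(1) \<phi>(2) by (intro sum_nonneg mult_nonneg_nonneg) (auto simp: less_imp_le)
  have G_nonneg: "0 \<le> G p" for p using R_nonneg Q_nonneg by (simp add: G_def)
  have R: "continuous_on UNIV R" unfolding R_def by (intro continuous_intros \<phi>(1))
  have G: "continuous_on UNIV G"
    unfolding G_def Q_def
    by (intro continuous_intros continuous_on_compose2[OF R] continuous_on_compose2[OF \<phi>(1)]; simp)
  have slice: "continuous_on UNIV (\<lambda>y. G (x, y))" "continuous_on UNIV (\<lambda>y. G (y, x))" for x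
    by (intro continuous_on_compose2[OF G] continuous_intros; simp)+
  have int_R: "(\<integral>x. R x \<partial>\<rho>) = \<theta>"
  proof -
    have "(\<integral>x. R x \<partial>\<rho>) = 1 - (1 - \<theta>) * (\<Sum>i\<in>I. b i / a i * a i)"
      unfolding R_def a_def using int[OF \<rho> \<phi>(1)] M.prob_space by simp
    also have "(\<Sum>i\<in>I. b i / a i * a i) = (\<Sum>i\<in>I. b i)"
      using a by (intro sum.cong) (auto simp: less_imp_neq[symmetric])
    finally show ?thesis using sum_b by simp
  qed
  have fst1: "(\<integral>y. G (x, y) \<partial>\<sigma>) = 1" for x
  proof -
    have "(\<integral>y. G (x, y) \<partial>\<sigma>) = (\<Sum>i\<in>I. (1 - \<theta>) / a i * (\<phi> i x * b i)) + R x"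
      unfolding G_def Q_def b_def using int[OF \<sigma> \<phi>(1)] N.prob_space by simp
    also have "\<dots> = 1" unfolding R_def sum_distrib_left by (simp add: sum_distrib_left ac_simps)
    finally show ?thesis .
  qed
  have snd1: "(\<integral>x. G (x, y) \<partial>\<rho>) = 1" for y
  proof -
    have "(\<integral>x. G (x, y) \<partial>\<rho>) = (\<Sum>i\<in>I. (1 - \<theta>) / a i * (a i * \<phi> i y)) + \<theta>"
      unfolding G_def Q_def a_def using int[OF \<rho> \<phi>(1)] int[OF \<rho> R] int_R by simp
    also have "(\<Sum>i\<in>I. (1 - \<theta>) / a i * (a i * \<phi> i y)) = (\<Sum>i\<in>I. (1 - \<theta>) * \<phi> i y)"
      using a by (intro sum.cong) (auto simp: less_imp_neq[symmetric])
    finally show ?thesis using \<phi>(3) by (simp add: sum_distrib_left[symmetric])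
  qed
  have G_meas: "(\<lambda>p. ennreal (G p)) \<in> borel_measurable (\<rho> \<Otimes>\<^sub>M \<sigma>)"
    using borel_measurable_integrable[OF integrable_continuous[OF cprod P G]] by simp
  define \<gamma> where "\<gamma> = density (\<rho> \<Otimes>\<^sub>M \<sigma>) (\<lambda>p. ennreal (G p))"
  have fst: "distr \<gamma> borel fst = \<rho>"
    unfolding \<gamma>_def
    by (rule distr_fst_density[OF \<rho> \<sigma> G_meas])
       (simp add: nn_integral_eq_integral int[OF \<sigma> slice(1)] G_nonneg fst1)
  have snd: "distr \<gamma> borel snd = \<sigma>"
    unfolding \<gamma>_def
    by (rule distr_snd_density[OF \<rho> \<sigma> G_meas])
       (simp add: nn_integral_eq_integral int[OF \<rho> slice(2)] G_nonneg snd1)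
  have sets: "sets \<gamma> = sets borel" unfolding \<gamma>_def using borel_probsD(2)[OF P] by simp
  have "fst \<in> \<gamma> \<rightarrow>\<^sub>M borel"
    unfolding measurable_cong_sets[OF sets refl]
    by (intro borel_measurable_continuous_onI continuous_intros)
  then have "prob_space \<gamma>" using fst M.prob_space_axioms by (intro prob_space_distrD[of fst \<gamma> borel]) auto
  then have coupling: "\<gamma> \<in> couplings \<rho> \<sigma>" using fst snd sets by (simp add: couplings_def space_prob_algebra)

  have cost: "G p * dist (fst p) (snd p) \<le> \<delta> * G p + D * R (fst p)" for p
  proof -
    have "Q p * dist (fst p) (snd p) \<le> \<delta> * Q p"
      unfolding Q_def sum_distrib_left sum_distrib_right
    proof (rule sum_mono)
      fix i assume i: "i \<in> I"
      let ?c = "(1 - \<theta>) / a i * (\<phi> i (fst p) * \<phi> i (snd p))"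
      have "?c \<ge> 0" using a[OF i] \<theta>(1) \<phi>(2)[OF i] by simp
      moreover have "dist (fst p) (snd p) \<le> \<delta>" if "?c \<noteq> 0"
        using \<delta>(2)[OF i, of "fst p" "snd p"] \<phi>(2)[OF i, of "fst p"] \<phi>(2)[OF i, of "snd p"] that
        by (auto simp: less_le)
      ultimately show "?c * dist (fst p) (snd p) \<le> \<delta> * ?c"
        by (cases "?c = 0") (auto simp only: mult.commute[of \<delta>] mult_zero_left intro: mult_left_mono)
    qed
    moreover have "R (fst p) * dist (fst p) (snd p) \<le> D * R (fst p)"
      using mult_left_mono[OF D R_nonneg] by (simp add: mult.commute)
    moreover have "0 \<le> \<delta> * R (fst p)" using \<delta>(1) R_nonneg by simp
    ultimately show ?thesis by (simp add: G_def algebra_simps)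
  qed
  have dist_meas: "(\<lambda>p. ennreal (dist (fst p) (snd p))) \<in> borel_measurable (\<rho> \<Otimes>\<^sub>M \<sigma>)"
    unfolding measurable_cong_sets[OF borel_probsD(2)[OF P] refl]
    by (intro measurable_compose[OF _ measurable_ennreal] borel_measurable_continuous_onI continuous_intros)
  have R': "continuous_on UNIV (\<lambda>p :: 'a \<times> 'a. R (fst p))"
    by (intro continuous_on_compose2[OF R] continuous_intros; simp)
  have int_P: "(\<integral>p. G p \<partial>(\<rho> \<Otimes>\<^sub>M \<sigma>)) = 1" "(\<integral>p. R (fst p) \<partial>(\<rho> \<Otimes>\<^sub>M \<sigma>)) = \<theta>"
    using fubini_continuous(1)[OF compact compact \<rho> \<sigma> G] fst1 M.prob_space
      fubini_continuous(1)[OF compact compact \<rho> \<sigma> R'] int_R N.prob_space by simp_all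
  have D0: "0 \<le> D" using D[of undefined undefined] by simp
  have "wasserstein \<rho> \<sigma> \<le> (\<integral>\<^sup>+(x, y). ennreal (dist x y) \<partial>\<gamma>)"
    unfolding wasserstein_def by (rule INF_lower[OF coupling])
  also have "\<dots> = (\<integral>\<^sup>+p. ennreal (G p) * ennreal (dist (fst p) (snd p)) \<partial>(\<rho> \<Otimes>\<^sub>M \<sigma>))"
    unfolding \<gamma>_def case_prod_beta by (rule nn_integral_density[OF G_meas dist_meas])
  also have "\<dots> \<le> (\<integral>\<^sup>+p. ennreal (\<delta> * G p + D * R (fst p)) \<partial>(\<rho> \<Otimes>\<^sub>M \<sigma>))"
    using cost G_nonneg by (intro nn_integral_mono) (auto simp: ennreal_mult[symmetric] intro!: ennreal_leI)
  also have "\<dots> = ennreal (\<integral>p. \<delta> * G p + D * R (fst p) \<partial>(\<rho> \<Otimes>\<^sub>M \<sigma>))"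
    using \<delta>(1) D0 G_nonneg R_nonneg
    by (intro nn_integral_eq_integral integrable_continuous[OF cprod P] continuous_intros G R') auto
  also have "(\<integral>p. \<delta> * G p + D * R (fst p) \<partial>(\<rho> \<Otimes>\<^sub>M \<sigma>)) = \<delta> + D * \<theta>"
    using int_P integrable_continuous[OF cprod P G] integrable_continuous[OF cprod P R'] by simp
  finally show ?thesis .
qed

lemma fine_partition_of_unity:
  fixes \<delta> :: real
  assumes "compact (UNIV :: 'a::metric_space set)" "\<delta> > 0"
  obtains C :: "'a::metric_space set" and \<phi> :: "'a \<Rightarrow> 'a \<Rightarrow> real"
  where "finite C" "\<And>c. continuous_on UNIV (\<phi> c)" "\<And>c x. 0 \<le> \<phi> c x" "\<And>x. (\<Sum>c\<in>C. \<phi> c x) = 1"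
    "\<And>c. 0 < \<phi> c c" "\<And>c x. 0 < \<phi> c x \<Longrightarrow> dist x c < \<delta>"
proof -
  obtain C :: "'a set" where C: "finite C" "UNIV \<subseteq> (\<Union>c\<in>C. ball c \<delta>)"
    using assms unfolding compact_eq_totally_bounded by auto
  define \<psi> where "\<psi> c x = max 0 (\<delta> - dist x c)" for c x :: 'a
  define S where "S x = (\<Sum>c\<in>C. \<psi> c x)" for x
  have S: "S x > 0" for x
  proof -
    obtain c where "c \<in> C" "x \<in> ball c \<delta>" using C(2) by blast
    then have "c \<in> C" "dist x c < \<delta>" by (simp_all add: dist_commute[of x c])
    then show ?thesis unfolding S_def using C(1) by (intro sum_pos2[of C c]) (auto simp: \<psi>_def)
  qed
  have "continuous_on UNIV (\<lambda>x. \<psi> c x / S x)" for c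
  proof (rule continuous_on_divide)
    show "continuous_on UNIV (\<psi> c)" "continuous_on UNIV S"
      unfolding S_def \<psi>_def by (intro continuous_intros)+
    show "\<forall>x\<in>UNIV. S x \<noteq> 0" using S by (simp add: less_imp_neq[symmetric])
  qed
  moreover have "(\<Sum>c\<in>C. \<psi> c x / S x) = 1" for x
    using S[of x] by (simp add: sum_divide_distrib[symmetric] S_def)
  moreover have "0 \<le> \<psi> c x / S x" for c x
    using S[of x] by (intro divide_nonneg_pos) (simp_all add: \<psi>_def)
  moreover have "0 < \<psi> c c / S c" for c
    using S[of c] \<open>\<delta> > 0\<close> by (intro divide_pos_pos) (simp_all add: \<psi>_def)
  moreover have "dist x c < \<delta>" if "0 < \<psi> c x / S x" for c x
    using that S[of x] by (simp add: \<psi>_def zero_less_divide_iff)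
  ultimately show thesis using that[of C "\<lambda>c x. \<psi> c x / S x"] C(1) by blast
qed

theorem theorem2p5:
  fixes K :: "'a::{metric_space, topological_ab_group_add} measure set"
    and h :: "'a measure"
    and \<epsilon> :: real
  assumes "compact (UNIV :: 'a set)"
    and "\<forall>(\<alpha>::'a) x y. dist (x + \<alpha>) (y + \<alpha>) = dist x y"
    and "haar_probability h"
    and "compactin weak_star_topology K"
    and "\<forall>\<mu>\<in>K. strictly_aperiodic \<mu>"
    and "\<epsilon> > 0"
  shows "\<exists>m\<ge>1. \<forall>\<mu> :: nat \<Rightarrow> 'a measure. (\<forall>i\<in>{1..m}. \<mu> i \<in> K) \<longrightarrow>
           (\<forall>\<nu>\<in>space (prob_algebra borel).
              wasserstein (fold conv (map \<mu> [1..<Suc m]) \<nu>) h < ennreal \<epsilon>)"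
proof -
  note compact = assms(1) and haar = assms(3) and h = haar_borel_probs[OF assms(3)]
  obtain D where D: "D > 0" "\<And>x y :: 'a. dist x y \<le> D"
  proof -
    obtain B where "\<And>x y :: 'a. dist x y \<le> B"
      using compact_imp_bounded[OF compact] by (auto simp: bounded_two_points)
    then show thesis using that[of "max 1 B"] by (simp add: le_max_iff_disj)
  qed
  \<comment> \<open>With pieces of diameter \<open>\<epsilon> / 2\<close> and a fraction \<open>\<theta>\<close> of misplaced mass the cost is at most
    \<open>\<epsilon> / 2 + D * \<theta> \<le> 3 * \<epsilon> / 4\<close>.\<close>
  define \<theta> where "\<theta> = min (1 / 2) (\<epsilon> / (4 * D))"
  have \<theta>: "0 < \<theta>" "\<theta> < 1" "D * \<theta> \<le> \<epsilon> / 4"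
    using D(1) \<open>\<epsilon> > 0\<close> by (auto simp: \<theta>_def min_def field_simps)
  obtain C :: "'a set" and \<phi> :: "'a \<Rightarrow> 'a \<Rightarrow> real" where C: "finite C"
    and \<phi>: "\<And>c. continuous_on UNIV (\<phi> c)" "\<And>c x. 0 \<le> \<phi> c x" "\<And>x. (\<Sum>c\<in>C. \<phi> c x) = 1"
      "\<And>c. 0 < \<phi> c c" "\<And>c x. 0 < \<phi> c x \<Longrightarrow> dist x c < \<epsilon> / 4"
    using fine_partition_of_unity[OF compact, of "\<epsilon> / 4"] \<open>\<epsilon> > 0\<close> by auto
  define b where "b c = (\<integral>x. \<phi> c x \<partial>h)" for c
  have b: "b c > 0" for c unfolding b_def by (rule integral_haar_pos[OF haar compact \<phi>(1,2,4)])
  have "\<forall>c. \<exists>n. \<forall>ms \<nu>. set ms \<subseteq> K \<longrightarrow> length ms \<ge> n \<longrightarrow> \<nu> \<in> borel_probs \<longrightarrow>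
      \<bar>(\<integral>x. \<phi> c x \<partial>fold conv ms \<nu>) - (\<integral>x. \<phi> c x \<partial>h)\<bar> \<le> \<theta> * b c"
    using b \<theta>(1) by (intro allI uniform_equidistribution[OF haar compact assms(4,5)] \<phi>(1) mult_pos_pos)
  then obtain n where n: "\<And>c ms \<nu>. set ms \<subseteq> K \<Longrightarrow> length ms \<ge> n c \<Longrightarrow> \<nu> \<in> borel_probs \<Longrightarrow>
      \<bar>(\<integral>x. \<phi> c x \<partial>fold conv ms \<nu>) - b c\<bar> \<le> \<theta> * b c"
    unfolding choice_iff b_def by blast
  define m where "m = Max (insert 1 (n ` C))"
  have m: "m \<ge> 1" "\<And>c. c \<in> C \<Longrightarrow> n c \<le> m" using C by (auto simp: m_def)
  have "wasserstein (fold conv (map \<mu> [1..<Suc m]) \<nu>) h < ennreal \<epsilon>"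
    if \<mu>: "\<forall>i\<in>{1..m}. \<mu> i \<in> K" and \<nu>: "\<nu> \<in> borel_probs"
    for \<mu> :: "nat \<Rightarrow> 'a measure" and \<nu>
  proof -
    define ms where "ms = map \<mu> [1..<Suc m]"
    have ms: "set ms \<subseteq> K" "length ms = m" using \<mu> by (auto simp: ms_def)
    have KP: "set ms \<subseteq> borel_probs" using ms(1) compactin_subset_topspace[OF assms(4)] by auto
    have walk: "fold conv ms \<nu> \<in> borel_probs"
      using KP \<nu> by (induction ms arbitrary: \<nu>) (auto intro!: conv_borel_probs[OF compact])
    have "wasserstein (fold conv ms \<nu>) h \<le> ennreal (\<epsilon> / 2 + D * \<theta>)"
    proof (rule wasserstein_le_partition[OF compact walk h C \<phi>(1,2,3)])
      show "0 \<le> \<epsilon> / 2" using \<open>\<epsilon> > 0\<close> by simp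
      show "dist x y \<le> \<epsilon> / 2" if "0 < \<phi> c x" "0 < \<phi> c y" for c x y
        using dist_triangle2[of x y c] \<phi>(5)[OF that(1)] \<phi>(5)[OF that(2)] by linarith
      show "dist x y \<le> D" for x y :: 'a by (rule D(2))
      show "\<theta> < 1" by (rule \<theta>(2))
      show "0 < (\<integral>x. \<phi> c x \<partial>h)" for c using b by (simp add: b_def)
      show "(1 - \<theta>) * (\<integral>x. \<phi> c x \<partial>h) \<le> (\<integral>x. \<phi> c x \<partial>fold conv ms \<nu>)" if "c \<in> C" for c
        using n[OF ms(1) _ \<nu>, of c] m(2)[OF that] ms(2) by (simp add: b_def algebra_simps)
    qed
    also have "\<dots> < ennreal \<epsilon>" using \<theta>(3) \<open>\<epsilon> > 0\<close> by (intro ennreal_lessI) auto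
    finally show ?thesis by (simp add: ms_def)
  qed
  with m(1) show ?thesis by blast
qed

end
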